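(* The following is provable in ZF (without the Axiom of Choice): $AC_{fin}^{\omega}$ is equivalent to $\mathcal{P}_{lf,c}$.
   Context: A graph is locally finite if every vertex has finite degree; it is connected if any two vertices are joined by a path of finite length. An independent set in a graph is a set of vertices no two of which are joined by an edge; a maximal independent set is an independent set that is not properly contained in any other independent set. $AC_{fin}^{\omega}$: every denumerable (i.e. countably infinite) family of non-empty finite sets has a choice function. $\mathcal{P}_{lf,c}$: every locally finite connected graph has a maximal independent set. *)

theory Defs
  imports Main
begin

text \<open>
  Isabelle/HOL itself validates the axiom of choice, so provability in ZF is expressed for
  a deep embedding: first-order formulas over the language of set theory, a natural deduction
  calculus for classical first-order logic with equality, and the axioms of ZF as a set of
  sentences. The Hilbert choice of HOL is not available inside the calculus.
\<close>

section \<open>First-order logic of set theory\<close>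

text \<open>
  Variables are de Bruijn indices. The language has no function symbols, so
  variables are the only terms and substitution is renaming.
\<close>

datatype form =
    Mem nat nat
  | Eq nat nat
  | Fls
  | Imp form form
  | Univ form

primrec ren :: "(nat \<Rightarrow> nat) \<Rightarrow> form \<Rightarrow> form" where
  "ren r (Mem i j) = Mem (r i) (r j)"
| "ren r (Eq i j) = Eq (r i) (r j)"
| "ren r Fls = Fls"
| "ren r (Imp p q) = Imp (ren r p) (ren r q)"
| "ren r (Univ p) = Univ (ren (case_nat 0 (\<lambda>i. Suc (r i))) p)"

definition inst :: "form \<Rightarrow> nat \<Rightarrow> form" where
  "inst p t = ren (case_nat t (\<lambda>i. i)) p"

text \<open>In \<open>UnivI\<close> the shift of the context is the eigenvariable condition.\<close>

inductive derives :: "form set \<Rightarrow> form \<Rightarrow> bool"  (infix "\<turnstile>" 20) where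
  Assm: "p \<in> G \<Longrightarrow> G \<turnstile> p"
| ImpI: "insert p G \<turnstile> q \<Longrightarrow> G \<turnstile> Imp p q"
| ImpE: "G \<turnstile> Imp p q \<Longrightarrow> G \<turnstile> p \<Longrightarrow> G \<turnstile> q"
| Raa: "insert (Imp p Fls) G \<turnstile> Fls \<Longrightarrow> G \<turnstile> p"
| UnivI: "ren Suc ` G \<turnstile> p \<Longrightarrow> G \<turnstile> Univ p"
| UnivE: "G \<turnstile> Univ p \<Longrightarrow> G \<turnstile> inst p t"
| EqRefl: "G \<turnstile> Eq t t"
| EqSubst: "G \<turnstile> Eq s t \<Longrightarrow> G \<turnstile> inst p s \<Longrightarrow> G \<turnstile> inst p t"

text \<open>The free variables of \<open>p\<close> are all below \<open>bnd p\<close>, and \<open>bnd p\<close> is the least such number.\<close>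

primrec bnd :: "form \<Rightarrow> nat" where
  "bnd (Mem i j) = max (Suc i) (Suc j)"
| "bnd (Eq i j) = max (Suc i) (Suc j)"
| "bnd Fls = 0"
| "bnd (Imp p q) = max (bnd p) (bnd q)"
| "bnd (Univ p) = bnd p - 1"

definition univ_closure :: "form \<Rightarrow> form" where
  "univ_closure p = (Univ ^^ bnd p) p"

section \<open>Writing formulas with bound names\<close>

text \<open>
  To write concrete formulas legibly, a formula is given as a function of the number \<open>d\<close> of
  enclosing quantifiers. A variable is then referred to by its level (the number of quantifiers
  enclosing its binder, so the outermost bound variable has level 0), which does not
  change under further quantifiers; level \<open>x\<close> at depth \<open>d\<close> is the index \<open>d - Suc x\<close>.
  The binder \<open>\<^bold>\<forall>\<close> passes the level of the new variable to its body.
\<close>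

type_synonym lform = "nat \<Rightarrow> form"

definition l_mem :: "nat \<Rightarrow> nat \<Rightarrow> lform"  (infix "\<^bold>\<in>" 50) where
  "(x \<^bold>\<in> y) = (\<lambda>d. Mem (d - Suc x) (d - Suc y))"

definition l_eq :: "nat \<Rightarrow> nat \<Rightarrow> lform"  (infix "\<^bold>=" 50) where
  "(x \<^bold>= y) = (\<lambda>d. Eq (d - Suc x) (d - Suc y))"

definition l_imp :: "lform \<Rightarrow> lform \<Rightarrow> lform"  (infixr "\<^bold>\<longrightarrow>" 25) where
  "(P \<^bold>\<longrightarrow> Q) = (\<lambda>d. Imp (P d) (Q d))"

definition l_all :: "(nat \<Rightarrow> lform) \<Rightarrow> lform"  (binder "\<^bold>\<forall>" 10) where
  "l_all P = (\<lambda>d. Univ (P d (Suc d)))"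

definition l_not :: "lform \<Rightarrow> lform"  ("\<^bold>\<not> _" [40] 40) where
  "(\<^bold>\<not> P) = (\<lambda>d. Imp (P d) Fls)"

definition l_and :: "lform \<Rightarrow> lform \<Rightarrow> lform"  (infixr "\<^bold>\<and>" 35) where
  "(P \<^bold>\<and> Q) = (\<^bold>\<not> (P \<^bold>\<longrightarrow> \<^bold>\<not> Q))"

definition l_or :: "lform \<Rightarrow> lform \<Rightarrow> lform"  (infixr "\<^bold>\<or>" 30) where
  "(P \<^bold>\<or> Q) = (\<^bold>\<not> P \<^bold>\<longrightarrow> Q)"

definition l_iff :: "lform \<Rightarrow> lform \<Rightarrow> lform"  (infixr "\<^bold>\<longleftrightarrow>" 25) where
  "(P \<^bold>\<longleftrightarrow> Q) = ((P \<^bold>\<longrightarrow> Q) \<^bold>\<and> (Q \<^bold>\<longrightarrow> P))"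

definition l_ex :: "(nat \<Rightarrow> lform) \<Rightarrow> lform"  (binder "\<^bold>\<exists>" 10) where
  "l_ex P = (\<^bold>\<not> (\<^bold>\<forall>x. \<^bold>\<not> P x))"

text \<open>
  \<open>plug p xs\<close> is the formula \<open>p\<close> with its first free indices replaced by the variables
  with levels \<open>xs\<close>; the remaining free indices of \<open>p\<close> are parameters, left free
  outside all the \<open>d\<close> enclosing quantifiers.
\<close>

definition plug :: "form \<Rightarrow> nat list \<Rightarrow> lform" where
  "plug p xs = (\<lambda>d. ren (\<lambda>i. if i < length xs then d - Suc (xs ! i) else d + (i - length xs)) p)"

definition formula :: "lform \<Rightarrow> form" where
  "formula P = P 0"

section \<open>Set-theoretic notions\<close>

definition l_subset :: "nat \<Rightarrow> nat \<Rightarrow> lform"  (infix "\<^bold>\<subseteq>" 50) where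
  "(x \<^bold>\<subseteq> y) = (\<^bold>\<forall>z. z \<^bold>\<in> x \<^bold>\<longrightarrow> z \<^bold>\<in> y)"

definition l_empty :: "nat \<Rightarrow> lform" where
  "l_empty x = (\<^bold>\<forall>z. \<^bold>\<not> z \<^bold>\<in> x)"

text \<open>\<open>a = {x, y}\<close>\<close>

definition l_upair :: "nat \<Rightarrow> nat \<Rightarrow> nat \<Rightarrow> lform" where
  "l_upair a x y = (\<^bold>\<forall>z. z \<^bold>\<in> a \<^bold>\<longleftrightarrow> z \<^bold>= x \<^bold>\<or> z \<^bold>= y)"

text \<open>\<open>p = (x, y) = {{x}, {x, y}}\<close>\<close>

definition l_opair :: "nat \<Rightarrow> nat \<Rightarrow> nat \<Rightarrow> lform" where
  "l_opair p x y = (\<^bold>\<exists>a. \<^bold>\<exists>b. l_upair a x x \<^bold>\<and> l_upair b x y \<^bold>\<and> l_upair p a b)"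

text \<open>\<open>y = x \<union> {x}\<close>\<close>

definition l_succ :: "nat \<Rightarrow> nat \<Rightarrow> lform" where
  "l_succ y x = (\<^bold>\<forall>z. z \<^bold>\<in> y \<^bold>\<longleftrightarrow> z \<^bold>\<in> x \<^bold>\<or> z \<^bold>= x)"

definition l_inductive :: "nat \<Rightarrow> lform" where
  "l_inductive a =
     ((\<^bold>\<exists>e. l_empty e \<^bold>\<and> e \<^bold>\<in> a) \<^bold>\<and>
      (\<^bold>\<forall>x. x \<^bold>\<in> a \<^bold>\<longrightarrow> (\<^bold>\<exists>y. l_succ y x \<^bold>\<and> y \<^bold>\<in> a)))"

definition l_omega :: "nat \<Rightarrow> lform" where
  "l_omega w = (l_inductive w \<^bold>\<and> (\<^bold>\<forall>a. l_inductive a \<^bold>\<longrightarrow> w \<^bold>\<subseteq> a))"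

definition l_nat :: "nat \<Rightarrow> lform" where
  "l_nat n = (\<^bold>\<exists>w. l_omega w \<^bold>\<and> n \<^bold>\<in> w)"

text \<open>\<open>(x, y) \<in> f\<close>\<close>

definition l_maps :: "nat \<Rightarrow> nat \<Rightarrow> nat \<Rightarrow> lform" where
  "l_maps f x y = (\<^bold>\<exists>p. l_opair p x y \<^bold>\<and> p \<^bold>\<in> f)"

text \<open>\<open>f\<close> is a function from \<open>a\<close> to \<open>b\<close>\<close>

definition l_fun :: "nat \<Rightarrow> nat \<Rightarrow> nat \<Rightarrow> lform" where
  "l_fun f a b =
     ((\<^bold>\<forall>p. p \<^bold>\<in> f \<^bold>\<longrightarrow> (\<^bold>\<exists>x. \<^bold>\<exists>y. x \<^bold>\<in> a \<^bold>\<and> y \<^bold>\<in> b \<^bold>\<and> l_opair p x y)) \<^bold>\<and>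
      (\<^bold>\<forall>x. x \<^bold>\<in> a \<^bold>\<longrightarrow> (\<^bold>\<exists>y. l_maps f x y \<^bold>\<and> (\<^bold>\<forall>z. l_maps f x z \<^bold>\<longrightarrow> z \<^bold>= y))))"

definition l_inj :: "nat \<Rightarrow> lform" where
  "l_inj f = (\<^bold>\<forall>x. \<^bold>\<forall>y. \<^bold>\<forall>z. l_maps f x z \<^bold>\<and> l_maps f y z \<^bold>\<longrightarrow> x \<^bold>= y)"

definition l_onto :: "nat \<Rightarrow> nat \<Rightarrow> lform" where
  "l_onto f b = (\<^bold>\<forall>y. y \<^bold>\<in> b \<^bold>\<longrightarrow> (\<^bold>\<exists>x. l_maps f x y))"

definition l_equipollent :: "nat \<Rightarrow> nat \<Rightarrow> lform" where
  "l_equipollent a b = (\<^bold>\<exists>f. l_fun f a b \<^bold>\<and> l_inj f \<^bold>\<and> l_onto f b)"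

definition l_finite :: "nat \<Rightarrow> lform" where
  "l_finite a = (\<^bold>\<exists>n. l_nat n \<^bold>\<and> l_equipollent a n)"

definition l_denumerable :: "nat \<Rightarrow> lform" where
  "l_denumerable a = (\<^bold>\<exists>w. l_omega w \<^bold>\<and> l_equipollent a w)"

section \<open>The axioms of ZF\<close>

definition ax_extensionality :: form where
  "ax_extensionality =
     formula (\<^bold>\<forall>x. \<^bold>\<forall>y. (\<^bold>\<forall>z. z \<^bold>\<in> x \<^bold>\<longleftrightarrow> z \<^bold>\<in> y) \<^bold>\<longrightarrow> x \<^bold>= y)"

definition ax_foundation :: form where
  "ax_foundation =
     formula (\<^bold>\<forall>x. (\<^bold>\<exists>y. y \<^bold>\<in> x) \<^bold>\<longrightarrow> (\<^bold>\<exists>y. y \<^bold>\<in> x \<^bold>\<and> \<^bold>\<not> (\<^bold>\<exists>z. z \<^bold>\<in> x \<^bold>\<and> z \<^bold>\<in> y)))"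

definition ax_pairing :: form where
  "ax_pairing = formula (\<^bold>\<forall>x. \<^bold>\<forall>y. \<^bold>\<exists>a. l_upair a x y)"

definition ax_union :: form where
  "ax_union =
     formula (\<^bold>\<forall>a. \<^bold>\<exists>u. \<^bold>\<forall>z. z \<^bold>\<in> u \<^bold>\<longleftrightarrow> (\<^bold>\<exists>x. x \<^bold>\<in> a \<^bold>\<and> z \<^bold>\<in> x))"

definition ax_powerset :: form where
  "ax_powerset = formula (\<^bold>\<forall>a. \<^bold>\<exists>u. \<^bold>\<forall>x. x \<^bold>\<in> u \<^bold>\<longleftrightarrow> x \<^bold>\<subseteq> a)"

definition ax_infinity :: form where
  "ax_infinity = formula (\<^bold>\<exists>a. l_inductive a)"

text \<open>
  In the two schemas the defining formula \<open>p\<close> may have parameters, bound by the universal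
  closure; by the definition of \<open>plug\<close>, the locally bound \<open>a\<close> and \<open>b\<close> do not occur in it.
\<close>

definition ax_separation :: "form \<Rightarrow> form" where
  "ax_separation p = univ_closure (formula
     (\<^bold>\<forall>a. \<^bold>\<exists>b. \<^bold>\<forall>x. x \<^bold>\<in> b \<^bold>\<longleftrightarrow> x \<^bold>\<in> a \<^bold>\<and> plug p [x]))"

definition ax_replacement :: "form \<Rightarrow> form" where
  "ax_replacement p = univ_closure (formula
     (\<^bold>\<forall>a. (\<^bold>\<forall>x. x \<^bold>\<in> a \<^bold>\<longrightarrow> (\<^bold>\<forall>y. \<^bold>\<forall>z. plug p [x, y] \<^bold>\<and> plug p [x, z] \<^bold>\<longrightarrow> y \<^bold>= z)) \<^bold>\<longrightarrow>
          (\<^bold>\<exists>b. \<^bold>\<forall>y. y \<^bold>\<in> b \<^bold>\<longleftrightarrow> (\<^bold>\<exists>x. x \<^bold>\<in> a \<^bold>\<and> plug p [x, y]))))"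

definition ZF :: "form set" where
  "ZF = {ax_extensionality, ax_foundation, ax_pairing, ax_union, ax_powerset, ax_infinity}
        \<union> range ax_separation \<union> range ax_replacement"

section \<open>Choice for denumerable families of finite sets\<close>

definition l_choice_function :: "nat \<Rightarrow> nat \<Rightarrow> lform" where
  "l_choice_function f a =
     ((\<^bold>\<exists>b. l_fun f a b) \<^bold>\<and> (\<^bold>\<forall>x. \<^bold>\<forall>y. l_maps f x y \<^bold>\<longrightarrow> y \<^bold>\<in> x))"

definition AC_fin_omega :: lform where
  "AC_fin_omega =
     (\<^bold>\<forall>a. l_denumerable a \<^bold>\<and> (\<^bold>\<forall>x. x \<^bold>\<in> a \<^bold>\<longrightarrow> (\<^bold>\<exists>y. y \<^bold>\<in> x) \<^bold>\<and> l_finite x) \<^bold>\<longrightarrow>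
          (\<^bold>\<exists>f. l_choice_function f a))"

section \<open>Maximal independent sets in locally finite connected graphs\<close>

text \<open>Graphs are simple and undirected: an edge is a set of two distinct vertices.\<close>

definition l_graph :: "nat \<Rightarrow> nat \<Rightarrow> lform" where
  "l_graph V E =
     (\<^bold>\<forall>e. e \<^bold>\<in> E \<^bold>\<longrightarrow>
        (\<^bold>\<exists>u. \<^bold>\<exists>v. u \<^bold>\<in> V \<^bold>\<and> v \<^bold>\<in> V \<^bold>\<and> \<^bold>\<not> u \<^bold>= v \<^bold>\<and> l_upair e u v))"

definition l_joined :: "nat \<Rightarrow> nat \<Rightarrow> nat \<Rightarrow> lform" where
  "l_joined E u v = (\<^bold>\<exists>e. e \<^bold>\<in> E \<^bold>\<and> l_upair e u v)"

definition l_locally_finite :: "nat \<Rightarrow> nat \<Rightarrow> lform" where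
  "l_locally_finite V E =
     (\<^bold>\<forall>v. v \<^bold>\<in> V \<^bold>\<longrightarrow>
        (\<^bold>\<exists>D. (\<^bold>\<forall>e. e \<^bold>\<in> D \<^bold>\<longleftrightarrow> e \<^bold>\<in> E \<^bold>\<and> v \<^bold>\<in> e) \<^bold>\<and> l_finite D))"

text \<open>A path of length \<open>n\<close> is an injective sequence of vertices indexed by \<open>m = n + 1 = {0, \<dots>, n}\<close>.\<close>

definition l_path :: "nat \<Rightarrow> nat \<Rightarrow> nat \<Rightarrow> nat \<Rightarrow> nat \<Rightarrow> nat \<Rightarrow> lform" where
  "l_path V E n p u v =
     ((\<^bold>\<exists>m. l_succ m n \<^bold>\<and> l_fun p m V) \<^bold>\<and> l_inj p \<^bold>\<and>
      (\<^bold>\<exists>z. l_empty z \<^bold>\<and> l_maps p z u) \<^bold>\<and> l_maps p n v \<^bold>\<and>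
      (\<^bold>\<forall>i. \<^bold>\<forall>j. \<^bold>\<forall>x. \<^bold>\<forall>y. i \<^bold>\<in> n \<^bold>\<and> l_succ j i \<^bold>\<and> l_maps p i x \<^bold>\<and> l_maps p j y \<^bold>\<longrightarrow>
         l_joined E x y))"

definition l_connected :: "nat \<Rightarrow> nat \<Rightarrow> lform" where
  "l_connected V E =
     (\<^bold>\<forall>u. \<^bold>\<forall>v. u \<^bold>\<in> V \<^bold>\<and> v \<^bold>\<in> V \<^bold>\<longrightarrow> (\<^bold>\<exists>n. \<^bold>\<exists>p. l_nat n \<^bold>\<and> l_path V E n p u v))"

definition l_independent :: "nat \<Rightarrow> nat \<Rightarrow> nat \<Rightarrow> lform" where
  "l_independent V E I =
     (I \<^bold>\<subseteq> V \<^bold>\<and> (\<^bold>\<forall>u. \<^bold>\<forall>v. u \<^bold>\<in> I \<^bold>\<and> v \<^bold>\<in> I \<^bold>\<longrightarrow> \<^bold>\<not> l_joined E u v))"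

definition l_maximal_independent :: "nat \<Rightarrow> nat \<Rightarrow> nat \<Rightarrow> lform" where
  "l_maximal_independent V E I =
     (l_independent V E I \<^bold>\<and>
      \<^bold>\<not> (\<^bold>\<exists>J. l_independent V E J \<^bold>\<and> I \<^bold>\<subseteq> J \<^bold>\<and> \<^bold>\<not> I \<^bold>= J))"

definition P_lf_c :: lform where
  "P_lf_c =
     (\<^bold>\<forall>V. \<^bold>\<forall>E. l_graph V E \<^bold>\<and> l_locally_finite V E \<^bold>\<and> l_connected V E \<^bold>\<longrightarrow>
        (\<^bold>\<exists>I. l_maximal_independent V E I))"

end

(*
  By the completeness theorem for the calculus it suffices to prove the equivalence in every model
  of ZF. In a model only definable collections are sets, so separation and induction are applied
  to predicates shown to be definable.

  AC => P: in a locally finite connected graph the set of endpoints of paths of length n from a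
  fixed root is finite, hence has finitely many orders. Choosing one for each n well-orders the
  vertices, and the greedy independent set along this order is maximal.

  P => AC: a graph made of two cliques for each member a of the family, with adjacent hubs and the
  elements of a as further vertices, is built so that a maximal independent set picks an element of
  a in at least one of its two cliques.
*)
theory Submission
  imports Defs "HOL-Library.Countable" "HOL-Library.Infinite_Set"
begin

section \<open>Completeness of the calculus\<close>

text \<open>Choice in HOL does not help inside a model, since a choice function counts there only if
  it is a set of the model. Conversely, once it is a set it may be a parameter of formulas.
  Definability therefore admits parameters, and an order built from a chosen sequence can enter
  separation and least-element arguments.

  From choice to independent sets, the obstacle is that in ZF a union of denumerably many finite
  sets need not be well-orderable. Local finiteness makes the set of orders of each sphere finite as
  well as non-empty, which is exactly the input that the weak choice principle accepts.

  In the converse direction the graph has to be connected without singling out an element of any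
  member, as that would already be a choice. Each member is therefore attached through an additional
  vertex, its hub. With one clique per member, an independent set could take the hub and select
  nothing; this is why the clique is doubled.\<close>

primrec fv :: "form \<Rightarrow> nat set" where
  "fv (Mem i j) = {i, j}"
| "fv (Eq i j) = {i, j}"
| "fv Fls = {}"
| "fv (Imp p q) = fv p \<union> fv q"
| "fv (Univ p) = {i. Suc i \<in> fv p}"

lemma finite_fv: "finite (fv p)"
proof (induction p)
  case (Univ p)
  have "{i. Suc i \<in> fv p} = Suc -` fv p" by auto
  then show ?case using Univ by (simp add: finite_vimageI)
qed auto

lemma fv_less_bnd: "i \<in> fv p \<Longrightarrow> i < bnd p"
  by (induction p arbitrary: i) (auto simp: less_max_iff_disj less_diff_conv)

lemma ren_cong: "(\<And>i. i \<in> fv p \<Longrightarrow> r i = s i) \<Longrightarrow> ren r p = ren s p"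
proof (induction p arbitrary: r s)
  case (Univ p)
  have "ren (case_nat 0 (\<lambda>i. Suc (r i))) p = ren (case_nat 0 (\<lambda>i. Suc (s i))) p"
    by (rule Univ.IH) (auto split: nat.split intro: Univ.prems)
  then show ?case by simp
next
  case (Imp p q)
  have "ren r p = ren s p" "ren r q = ren s q" by (auto intro!: Imp)
  then show ?case by simp
qed auto

lemma ren_ren: "ren r (ren s p) = ren (\<lambda>i. r (s i)) p"
proof (induction p arbitrary: r s)
  case (Univ p)
  have "(\<lambda>i. case_nat 0 (\<lambda>i. Suc (r i)) (case_nat 0 (\<lambda>i. Suc (s i)) i))
      = case_nat 0 (\<lambda>i. Suc (r (s i)))"
    by (auto split: nat.split)
  then show ?case by (simp add: Univ)
qed auto

lemma ren_id: "ren (\<lambda>i. i) p = p"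
proof (induction p)
  case (Univ p)
  have "case_nat 0 Suc = (\<lambda>i. i)" by (auto split: nat.split)
  then show ?case using Univ by simp
qed auto

lemma fv_ren: "fv (ren r p) \<subseteq> r ` fv p"
proof (induction p arbitrary: r)
  case (Univ p)
  show ?case
  proof
    fix i assume "i \<in> fv (ren r (Univ p))"
    then have "Suc i \<in> case_nat 0 (\<lambda>i. Suc (r i)) ` fv p" using Univ by auto
    then obtain j where "j \<in> fv p" "Suc i = case_nat 0 (\<lambda>i. Suc (r i)) j" by auto
    then show "i \<in> r ` fv (Univ p)" by (cases j) auto
  qed
qed force+

lemma ren_inst: "ren r (inst p t) = inst (ren (case_nat 0 (\<lambda>i. Suc (r i))) p) (r t)"
  unfolding inst_def ren_ren by (rule ren_cong) (auto split: nat.split)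

section \<open>Structural properties of derivability\<close>

text \<open>The renaming need not be injective. Under \<open>UnivI\<close> it is lifted past the
  bound variable, which commutes with the shift of the context; hence \<open>r\<close> is arbitrary
  in the induction.\<close>

lemma derives_ren: "G \<turnstile> p \<Longrightarrow> ren r ` G \<turnstile> ren r p"
proof (induction arbitrary: r rule: derives.induct)
  case (UnivI G p)
  let ?r = "case_nat 0 (\<lambda>i. Suc (r i))"
  have "ren ?r ` ren Suc ` G = ren Suc ` ren r ` G"
    by (simp add: image_image ren_ren)
  then show ?case using UnivI.IH[of ?r] by (simp add: derives.UnivI)
next
  case (UnivE G p t)
  then show ?case unfolding ren_inst by (metis derives.UnivE ren.simps(5))
next
  case (EqSubst G s t p)
  then show ?case unfolding ren_inst by (metis derives.EqSubst ren.simps(2))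
next
  case (Raa p G)
  then show ?case by (metis derives.Raa image_insert ren.simps(3,4))
next
  case (ImpE G p q)
  then show ?case by (metis derives.ImpE ren.simps(4))
qed (auto intro: derives.intros)

lemma derives_mono: "G \<turnstile> p \<Longrightarrow> G \<subseteq> H \<Longrightarrow> H \<turnstile> p"
proof (induction arbitrary: H rule: derives.induct)
  case (ImpI p G q)
  then show ?case by (meson derives.ImpI insert_mono)
next
  case (Raa p G)
  then show ?case by (meson derives.Raa insert_mono)
next
  case (UnivI G p)
  then show ?case by (meson derives.UnivI image_mono)
next
  case (EqSubst G s t p)
  then show ?case by (meson derives.EqSubst)
qed (auto intro: derives.intros)

text \<open>A derivation uses finitely many assumptions. Discharged assumptions are removed from the
  finite set again, and under \<open>UnivI\<close> that set is pulled back along the shift.\<close>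

lemma derives_finite: "G \<turnstile> p \<Longrightarrow> \<exists>F. finite F \<and> F \<subseteq> G \<and> (F \<turnstile> p)"
proof (induction rule: derives.induct)
  case (Assm p G)
  then show ?case by (intro exI[of _ "{p}"]) (auto intro: derives.Assm)
next
  case (ImpI p G q)
  then obtain F where "finite F" "F \<subseteq> insert p G" "F \<turnstile> q" by blast
  then show ?case
    by (intro exI[of _ "F - {p}"]) (auto intro: derives.ImpI[OF derives_mono[of F]])
next
  case (ImpE G p q)
  then obtain F F' where F: "finite F" "F \<subseteq> G" "F \<turnstile> Imp p q" "finite F'" "F' \<subseteq> G" "F' \<turnstile> p"
    by blast
  have "F \<union> F' \<turnstile> q"
    by (rule derives.ImpE; rule derives_mono, fact) auto
  then show ?case using F by (intro exI[of _ "F \<union> F'"]) auto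
next
  case (Raa p G)
  then obtain F where "finite F" "F \<subseteq> insert (Imp p Fls) G" "F \<turnstile> Fls" by blast
  then show ?case
    by (intro exI[of _ "F - {Imp p Fls}"]) (auto intro: derives.Raa[OF derives_mono[of F]])
next
  case (UnivI G p)
  then obtain F where "finite F" "F \<subseteq> ren Suc ` G" "F \<turnstile> p" by blast
  then obtain F' where "finite F'" "F' \<subseteq> G" "ren Suc ` F' \<turnstile> p"
    by (metis finite_subset_image)
  then show ?case by (blast intro: derives.UnivI)
next
  case (UnivE G p t)
  then show ?case by (blast intro: derives.UnivE)
next
  case (EqRefl G t)
  then show ?case by (blast intro: derives.EqRefl)
next
  case (EqSubst G s t p)
  then obtain F F' where F: "finite F" "F \<subseteq> G" "F \<turnstile> Eq s t" "finite F'" "F' \<subseteq> G" "F' \<turnstile> inst p s"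
    by blast
  have "F \<union> F' \<turnstile> inst p t"
    by (rule derives.EqSubst; rule derives_mono, fact) auto
  then show ?case using F by (intro exI[of _ "F \<union> F'"]) auto
qed

text \<open>The renaming that takes \<open>t\<close> to 0 and shifts all else undoes the
  instantiation; on \<open>G\<close>, where \<open>t\<close> does not occur, it is the plain shift
  that \<open>UnivI\<close> asks for.\<close>

lemma derives_generalize:
  assumes "G \<turnstile> inst p t" and fresh: "\<And>q. q \<in> insert (Univ p) G \<Longrightarrow> t \<notin> fv q"
  shows "G \<turnstile> Univ p"
proof (rule UnivI)
  let ?r = "\<lambda>i. if i = t then 0 else Suc i"
  have "ren ?r (inst p t) = ren (\<lambda>i. i) p"
    unfolding inst_def ren_ren using fresh[of "Univ p"]
    by (intro ren_cong) (auto split: nat.split)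
  moreover have "ren ?r ` G = ren Suc ` G"
    using fresh by (intro image_cong refl ren_cong) auto
  ultimately show "ren Suc ` G \<turnstile> p"
    using derives_ren[OF assms(1), of ?r] by (simp add: ren_id)
qed

section \<open>Henkin's extension to a complete theory with counterexamples\<close>

instance form :: countable by countable_datatype

abbreviation consistent :: "form set \<Rightarrow> bool" where
  "consistent G \<equiv> \<not> (G \<turnstile> Fls)"

definition fresh_for :: "form set \<Rightarrow> nat" where
  "fresh_for S = (SOME t. \<forall>q\<in>S. t \<notin> fv q)"

text \<open>With only the universal quantifier primitive, a Henkin witness is a counterexample to a
  refuted universal formula. For a formula of any other shape the set is empty.\<close>

definition witnesses :: "form set \<Rightarrow> form \<Rightarrow> form set" where
  "witnesses S p = {Imp (inst q (fresh_for S)) Fls | q. p = Imp (Univ q) Fls}"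

primrec henkin :: "form set \<Rightarrow> nat \<Rightarrow> form set" where
  "henkin G 0 = G"
| "henkin G (Suc n) =
    (let p = from_nat n; S = insert p (henkin G n)
     in if (S \<turnstile> Fls) then henkin G n else S \<union> witnesses S p)"

lemma fresh_for: "infinite (- (\<Union>q\<in>S. fv q)) \<Longrightarrow> q \<in> S \<Longrightarrow> fresh_for S \<notin> fv q"
proof -
  assume inf: "infinite (- (\<Union>q\<in>S. fv q))" and "q \<in> S"
  obtain t where "t \<in> - (\<Union>q\<in>S. fv q)"
    using infinite_imp_nonempty[OF inf] by blast
  then have "\<forall>q\<in>S. fresh_for S \<notin> fv q"
    unfolding fresh_for_def by (intro someI_ex[of "\<lambda>t. \<forall>q\<in>S. t \<notin> fv q"]) blast
  then show ?thesis using \<open>q \<in> S\<close> by blast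
qed

lemma finite_witnesses: "finite (witnesses S p)"
proof (cases "\<exists>q. p = Imp (Univ q) Fls")
  case True
  then obtain q where "p = Imp (Univ q) Fls" by blast
  then have "witnesses S p = {Imp (inst q (fresh_for S)) Fls}" by (auto simp: witnesses_def)
  then show ?thesis by simp
qed (simp add: witnesses_def)

lemma infinite_fresh_union:
  assumes "infinite (- (\<Union>q\<in>S. fv q))" "finite F"
  shows "infinite (- (\<Union>q\<in>S \<union> F. fv q))"
proof -
  have "- (\<Union>q\<in>S \<union> F. fv q) = - (\<Union>q\<in>S. fv q) - (\<Union>q\<in>F. fv q)" by auto
  moreover have "finite (\<Union>q\<in>F. fv q)" using assms finite_fv by auto
  ultimately show ?thesis using assms by (metis Diff_infinite_finite)
qed

lemma henkin_invariant:
  assumes "consistent G" "infinite (- (\<Union>q\<in>G. fv q))"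
  shows "consistent (henkin G n) \<and> infinite (- (\<Union>q\<in>henkin G n. fv q))"
proof (induction n)
  case 0
  then show ?case using assms by simp
next
  case (Suc n)
  define p :: form where "p = from_nat n"
  define S where "S = insert p (henkin G n)"
  show ?case
  proof (cases "S \<turnstile> Fls")
    case True
    then show ?thesis using Suc by (simp add: S_def p_def)
  next
    case False
    have eq: "henkin G (Suc n) = S \<union> witnesses S p"
      using False by (simp add: S_def p_def Let_def)
    have inf: "infinite (- (\<Union>q\<in>S. fv q))"
      using infinite_fresh_union[of "henkin G n" "{p}"] Suc by (simp add: S_def)
    have "consistent (S \<union> witnesses S p)"
    proof
      assume incons: "S \<union> witnesses S p \<turnstile> Fls"
      then have "witnesses S p \<noteq> {}" using False by force
      then obtain q where q: "p = Imp (Univ q) Fls" by (auto simp: witnesses_def)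
      then have "witnesses S p = {Imp (inst q (fresh_for S)) Fls}" by (auto simp: witnesses_def)
      then have "S \<turnstile> inst q (fresh_for S)" using incons by (simp add: Raa)
      moreover have "fresh_for S \<notin> fv q'" if "q' \<in> insert (Univ q) S" for q'
        using that fresh_for[OF inf, of q'] fresh_for[OF inf, of p] q by (auto simp: S_def)
      ultimately have "S \<turnstile> Univ q" by (rule derives_generalize)
      moreover have "S \<turnstile> Imp (Univ q) Fls" using q by (auto simp: S_def intro: Assm)
      ultimately show False using False ImpE by blast
    qed
    then show ?thesis
      unfolding eq using infinite_fresh_union[OF inf finite_witnesses] by blast
  qed
qed

lemma henkin_mono: "m \<le> n \<Longrightarrow> henkin G m \<subseteq> henkin G n"
  by (rule lift_Suc_mono_le[of "henkin G"]) (auto simp: Let_def)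

locale henkin_theory =
  fixes G :: "form set"
  assumes cons: "consistent G" and fresh: "infinite (- (\<Union>q\<in>G. fv q))"
begin

definition T :: "form set" where
  "T = (\<Union>n. henkin G n)"

lemma G_subset: "G \<subseteq> T"
  unfolding T_def using henkin.simps(1) by blast

lemma consistent_T: "consistent T"
proof
  assume "T \<turnstile> Fls"
  then obtain F where F: "finite F" "F \<subseteq> T" "F \<turnstile> Fls" using derives_finite by blast
  have "\<exists>n. F \<subseteq> henkin G n"
    using F(1,2)
  proof (induction F rule: finite_induct)
    case (insert x F)
    then obtain n m where "F \<subseteq> henkin G n" "x \<in> henkin G m" by (auto simp: T_def)
    then have "insert x F \<subseteq> henkin G (max n m)"
      using henkin_mono[of n "max n m" G] henkin_mono[of m "max n m" G] by auto
    then show ?case by blast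
  qed simp
  then show False using F(3) derives_mono henkin_invariant[OF cons fresh] by blast
qed

text \<open>A formula is decided at its own stage: either it is inconsistent with what is already
  there, or it enters together with its counterexample. Completeness of \<open>T\<close> and the
  quantifier clause both come from this dichotomy.\<close>

lemma T_stage: "(insert p T \<turnstile> Fls) \<or>
  insert p (henkin G (to_nat p)) \<union> witnesses (insert p (henkin G (to_nat p))) p \<subseteq> T"
proof (cases "insert p (henkin G (to_nat p)) \<turnstile> Fls")
  case True
  have "insert p (henkin G (to_nat p)) \<subseteq> insert p T" by (auto simp: T_def)
  then show ?thesis using True derives_mono by blast
next
  case False
  have "henkin G (Suc (to_nat p)) \<subseteq> T" unfolding T_def by blast
  then show ?thesis using False by (simp add: Let_def)
qed

lemma T_derives: "(T \<turnstile> p) \<longleftrightarrow> p \<in> T"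
proof
  assume p: "T \<turnstile> p"
  show "p \<in> T"
  proof (rule ccontr)
    assume "p \<notin> T"
    then have "insert p T \<turnstile> Fls" using T_stage[of p] by auto
    then show False using p consistent_T ImpI ImpE by blast
  qed
qed (rule Assm)

lemma T_neg: "Imp p Fls \<in> T \<longleftrightarrow> p \<notin> T"
proof
  assume "Imp p Fls \<in> T"
  then show "p \<notin> T" using consistent_T Assm ImpE by blast
next
  assume "p \<notin> T"
  then have "insert p T \<turnstile> Fls" using T_stage[of p] by auto
  then show "Imp p Fls \<in> T" using ImpI T_derives by blast
qed

lemma T_Fls: "Fls \<notin> T"
  using consistent_T T_derives by blast

lemma T_Imp: "Imp p q \<in> T \<longleftrightarrow> (p \<in> T \<longrightarrow> q \<in> T)"
proof
  show "Imp p q \<in> T \<Longrightarrow> p \<in> T \<longrightarrow> q \<in> T" using T_derives ImpE by blast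
  assume *: "p \<in> T \<longrightarrow> q \<in> T"
  show "Imp p q \<in> T"
  proof (cases "p \<in> T")
    case True
    then have "insert p T \<turnstile> q" using * by (auto intro: Assm)
    then show ?thesis using ImpI T_derives by blast
  next
    case False
    then have "T \<turnstile> Imp p Fls" using T_neg T_derives by blast
    then have "insert (Imp q Fls) (insert p T) \<turnstile> Imp p Fls"
      by (rule derives_mono) auto
    then have "insert (Imp q Fls) (insert p T) \<turnstile> Fls"
      by (rule ImpE) (simp add: Assm)
    then show ?thesis using Raa ImpI T_derives by blast
  qed
qed

lemma T_Univ: "Univ p \<in> T \<longleftrightarrow> (\<forall>t. inst p t \<in> T)"
proof
  show "Univ p \<in> T \<Longrightarrow> \<forall>t. inst p t \<in> T" using T_derives UnivE by blast
  assume all: "\<forall>t. inst p t \<in> T"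
  show "Univ p \<in> T"
  proof (rule ccontr)
    let ?q = "Imp (Univ p) Fls"
    assume "Univ p \<notin> T"
    then have "?q \<in> T" by (simp add: T_neg)
    \<comment> \<open>The formula already belongs to \<open>T\<close>, so inserting it changes
      nothing, and the second alternative of \<open>T_stage\<close> must hold.\<close>
    then have "\<not> (insert ?q T \<turnstile> Fls)" using consistent_T by (simp add: insert_absorb)
    then have "witnesses (insert ?q (henkin G (to_nat ?q))) ?q \<subseteq> T"
      using T_stage[of ?q] by auto
    then obtain t where "Imp (inst p t) Fls \<in> T" by (auto simp: witnesses_def)
    then show False using all T_neg by blast
  qed
qed

lemma T_refl: "Eq i i \<in> T"
  using T_derives EqRefl by blast

lemma T_subst: "Eq i j \<in> T \<Longrightarrow> inst p i \<in> T \<Longrightarrow> inst p j \<in> T"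
  using T_derives EqSubst by blast

text \<open>In the template \<open>Eq 0 (Suc i)\<close> the index 0 marks the place to be replaced,
  while \<open>Suc i\<close> becomes \<open>i\<close> on instantiation. The templates in the next
  two lemmas are read alike.\<close>

lemma T_sym: "Eq i j \<in> T \<Longrightarrow> Eq j i \<in> T"
  using T_subst[of i j "Eq 0 (Suc i)"] T_refl by (simp add: inst_def)

lemma T_trans: "Eq i j \<in> T \<Longrightarrow> Eq j k \<in> T \<Longrightarrow> Eq i k \<in> T"
  using T_subst[of j k "Eq (Suc i) 0"] by (simp add: inst_def)

lemma T_Mem: "Eq i i' \<in> T \<Longrightarrow> Eq j j' \<in> T \<Longrightarrow> Mem i j \<in> T \<Longrightarrow> Mem i' j' \<in> T"
  using T_subst[of i i' "Mem 0 (Suc j)"] T_subst[of j j' "Mem (Suc i') 0"]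
  by (simp add: inst_def)

end

section \<open>Satisfaction and the term model\<close>

text \<open>Equality is interpreted by an arbitrary relation \<open>Q\<close>, because the term
  model provides only a congruence; true equality comes with the passage to the quotient.\<close>

primrec sat :: "('a \<Rightarrow> 'a \<Rightarrow> bool) \<Rightarrow> ('a \<Rightarrow> 'a \<Rightarrow> bool) \<Rightarrow> (nat \<Rightarrow> 'a) \<Rightarrow> form \<Rightarrow> bool" where
  "sat Q M e (Mem i j) = M (e i) (e j)"
| "sat Q M e (Eq i j) = Q (e i) (e j)"
| "sat Q M e Fls = False"
| "sat Q M e (Imp p q) = (sat Q M e p \<longrightarrow> sat Q M e q)"
| "sat Q M e (Univ p) = (\<forall>x. sat Q M (case_nat x e) p)"

lemma sat_cong: "(\<And>i. i \<in> fv p \<Longrightarrow> e i = e' i) \<Longrightarrow> sat Q M e p = sat Q M e' p"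
proof (induction p arbitrary: e e')
  case (Univ p)
  have "sat Q M (case_nat x e) p = sat Q M (case_nat x e') p" for x
    by (rule Univ.IH) (auto split: nat.split intro: Univ.prems)
  then show ?case by simp
next
  case (Imp p q)
  have "sat Q M e p = sat Q M e' p" "sat Q M e q = sat Q M e' q" by (auto intro!: Imp)
  then show ?case by simp
qed auto

lemma sat_ren: "sat Q M e (ren r p) = sat Q M (\<lambda>i. e (r i)) p"
proof (induction p arbitrary: e r)
  case (Univ p)
  have "(\<lambda>i. case_nat x e (case_nat 0 (\<lambda>i. Suc (r i)) i)) = case_nat x (\<lambda>i. e (r i))" for x
    by (auto split: nat.split)
  then show ?case by (simp add: Univ)
qed auto

text \<open>Variables are the only terms, so the elements of the term model are variables and an
  environment is itself a renaming.\<close>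

lemma (in henkin_theory) truth:
  "sat (\<lambda>i j. Eq i j \<in> T) (\<lambda>i j. Mem i j \<in> T) e p \<longleftrightarrow> ren e p \<in> T"
proof (induction p arbitrary: e)
  case (Univ p)
  have "ren (case_nat x e) p = inst (ren (case_nat 0 (\<lambda>i. Suc (e i))) p) x" for x
    unfolding inst_def ren_ren by (rule ren_cong) (auto split: nat.split)
  then show ?case by (simp add: Univ T_Univ)
qed (simp_all add: T_Fls T_Imp)

text \<open>Renaming \<open>G\<close> to even variables makes room for the Henkin witnesses.\<close>

theorem model_existence:
  assumes "consistent G"
  obtains Q M :: "nat \<Rightarrow> nat \<Rightarrow> bool" and e where "equivp Q"
    "\<And>i i' j j'. Q i i' \<Longrightarrow> Q j j' \<Longrightarrow> M i j \<Longrightarrow> M i' j'"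
    "\<And>p. p \<in> G \<Longrightarrow> sat Q M e p"
proof -
  let ?H = "ren (\<lambda>i. 2 * i) ` G"
  have cons: "consistent ?H"
  proof
    assume "?H \<turnstile> Fls"
    from derives_ren[OF this, of "\<lambda>i. i div 2"] have "G \<turnstile> Fls"
      by (simp add: image_image ren_ren ren_id)
    then show False using assms by blast
  qed
  have "range (\<lambda>i::nat. Suc (2 * i)) \<subseteq> - (\<Union>q\<in>?H. fv q)"
  proof -
    have "Suc (2 * i) \<notin> fv (ren (\<lambda>i. 2 * i) p)" for i p
      using fv_ren[of "\<lambda>i. 2 * i" p] by (metis (no_types, lifting) dvd_triv_left imageE odd_Suc_div_two even_Suc subsetD)
    then show ?thesis by auto
  qed
  moreover have "infinite (range (\<lambda>i::nat. Suc (2 * i)))"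
    by (rule range_inj_infinite) (auto intro: injI)
  ultimately have "infinite (- (\<Union>q\<in>?H. fv q))" using finite_subset by blast
  then interpret henkin_theory ?H using cons by unfold_locales
  show ?thesis
  proof (rule that[of "\<lambda>i j. Eq i j \<in> T" "\<lambda>i j. Mem i j \<in> T" "\<lambda>i. 2 * i"])
    show "equivp (\<lambda>i j. Eq i j \<in> T)"
      using T_refl T_sym T_trans by (intro equivpI reflpI sympI transpI) blast+
    show "sat (\<lambda>i j. Eq i j \<in> T) (\<lambda>i j. Mem i j \<in> T) (\<lambda>i. 2 * i) p" if "p \<in> G" for p
      using that G_subset by (auto simp: truth)
  qed (rule T_Mem)
qed

section \<open>Semantics of formulas with bound names\<close>

text \<open>Values are indexed by levels rather than by de Bruijn indices: entering a quantifier
  updates \<open>v\<close> at \<open>d\<close> and shifts nothing. The environment \<open>e\<close>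
  serves the indices that point beyond all \<open>d\<close> quantifiers.\<close>

definition holds ::
    "('a \<Rightarrow> 'a \<Rightarrow> bool) \<Rightarrow> ('a \<Rightarrow> 'a \<Rightarrow> bool) \<Rightarrow> (nat \<Rightarrow> 'a) \<Rightarrow> nat \<Rightarrow> (nat \<Rightarrow> 'a) \<Rightarrow> lform \<Rightarrow> bool" where
  "holds Q M e d v P = sat Q M (\<lambda>i. if i < d then v (d - Suc i) else e (i - d)) (P d)"

lemma sat_formula: "sat Q M e (formula P) = holds Q M e 0 v P"
  by (simp add: formula_def holds_def)

lemma holds_mem: "x < d \<Longrightarrow> y < d \<Longrightarrow> holds Q M e d v (x \<^bold>\<in> y) = M (v x) (v y)"
  by (simp add: holds_def l_mem_def)

lemma holds_eq: "x < d \<Longrightarrow> y < d \<Longrightarrow> holds Q M e d v (x \<^bold>= y) = Q (v x) (v y)"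
  by (simp add: holds_def l_eq_def)

lemma holds_imp: "holds Q M e d v (P \<^bold>\<longrightarrow> R) = (holds Q M e d v P \<longrightarrow> holds Q M e d v R)"
  by (simp add: holds_def l_imp_def)

lemma holds_not: "holds Q M e d v (\<^bold>\<not> P) = (\<not> holds Q M e d v P)"
  by (simp add: holds_def l_not_def)

lemma holds_and: "holds Q M e d v (P \<^bold>\<and> R) = (holds Q M e d v P \<and> holds Q M e d v R)"
  by (simp add: l_and_def holds_not holds_imp)

lemma holds_or: "holds Q M e d v (P \<^bold>\<or> R) = (holds Q M e d v P \<or> holds Q M e d v R)"
  by (auto simp: l_or_def holds_not holds_imp)

lemma holds_iff: "holds Q M e d v (P \<^bold>\<longleftrightarrow> R) = (holds Q M e d v P \<longleftrightarrow> holds Q M e d v R)"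
  by (auto simp: l_iff_def holds_and holds_imp)

lemma holds_all: "holds Q M e d v (l_all P) = (\<forall>x. holds Q M e (Suc d) (v(d := x)) (P d))"
proof -
  have "case_nat x (\<lambda>i. if i < d then v (d - Suc i) else e (i - d)) =
    (\<lambda>i. if i < Suc d then (v(d := x)) (Suc d - Suc i) else e (i - Suc d))" for x
    by (auto simp: fun_eq_iff split: nat.split)
  then show ?thesis by (simp add: holds_def l_all_def)
qed

lemma holds_ex: "holds Q M e d v (l_ex P) = (\<exists>x. holds Q M e (Suc d) (v(d := x)) (P d))"
  by (simp add: l_ex_def holds_not holds_all)

text \<open>Bound levels outside \<open>xs\<close> are skipped, so the parameters of
  \<open>p\<close> read the same values of \<open>e\<close> at every depth.\<close>

lemma holds_plug:
  assumes "\<forall>x\<in>set xs. x < d"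
  shows "holds Q M e d v (plug p xs) =
    sat Q M (\<lambda>i. if i < length xs then v (xs ! i) else e (i - length xs)) p"
proof -
  have "(\<lambda>i. (\<lambda>j. if j < d then v (d - Suc j) else e (j - d))
      (if i < length xs then d - Suc (xs ! i) else d + (i - length xs))) =
    (\<lambda>i. if i < length xs then v (xs ! i) else e (i - length xs))"
    (is "?f = ?g")
  proof
    fix i show "?f i = ?g i"
    proof (cases "i < length xs")
      case True
      then have "xs ! i < d" using assms by simp
      then show ?thesis using True by simp
    next
      case False
      have "\<not> d + (i - length xs) < d" "d + (i - length xs) - d = i - length xs" by simp_all
      then show ?thesis using False by presburger
    qed
  qed
  then show ?thesis by (simp add: holds_def plug_def sat_ren)
qed

lemmas holds_simps =
  holds_mem holds_eq holds_imp holds_not holds_and holds_or holds_iff holds_all holds_ex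

section \<open>From the term model to a countable model of ZF with true equality\<close>

lemma fv_univ_closure: "fv (univ_closure p) = {}"
proof -
  have "i \<in> fv ((Univ ^^ n) p) \<longleftrightarrow> i + n \<in> fv p" for i n
    by (induction n arbitrary: i) auto
  then show ?thesis
    using fv_less_bnd[of _ p] unfolding univ_closure_def by fastforce
qed

text \<open>The closure is a sentence, so its truth passes from \<open>e\<close> to every
  environment. The induction then strips quantifiers from a formula that is true in all
  environments.\<close>

lemma sat_univ_closure:
  assumes "sat Q M e (univ_closure p)"
  shows "sat Q M e' p"
proof -
  have "(\<forall>e. sat Q M e ((Univ ^^ n) p)) \<longrightarrow> (\<forall>e. sat Q M e p)" for n
  proof (induction n)
    case (Suc n)
    show ?case
    proof
      assume *: "\<forall>e. sat Q M e ((Univ ^^ Suc n) p)"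
      have "sat Q M e ((Univ ^^ n) p)" for e
      proof -
        have "sat Q M (case_nat (e 0) (\<lambda>i. e (Suc i))) ((Univ ^^ n) p)" using * by simp
        moreover have "case_nat (e 0) (\<lambda>i. e (Suc i)) = e" by (auto split: nat.split)
        ultimately show ?thesis by simp
      qed
      then show "\<forall>e. sat Q M e p" using Suc by blast
    qed
  qed simp
  moreover have "sat Q M e'' (univ_closure p)" for e''
    using assms sat_cong[of "univ_closure p"] fv_univ_closure[of p] by blast
  ultimately show ?thesis unfolding univ_closure_def by blast
qed

text \<open>The environment \<open>e'\<close> is arbitrary, so any elements of the model can be
  parameters of the separated class.\<close>

lemma sat_separation:
  assumes "\<And>p. p \<in> ZF \<Longrightarrow> sat Q M e p"
  shows "\<exists>b. \<forall>x. M x b \<longleftrightarrow> M x a \<and> sat Q M (case_nat x e') p"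
proof -
  have "sat Q M e (ax_separation p)" using assms by (simp add: ZF_def)
  then have "sat Q M e' (formula
     (\<^bold>\<forall>a. \<^bold>\<exists>b. \<^bold>\<forall>x. x \<^bold>\<in> b \<^bold>\<longleftrightarrow> x \<^bold>\<in> a \<^bold>\<and> plug p [x]))"
    unfolding ax_separation_def by (rule sat_univ_closure)
  then have *: "\<forall>a. \<exists>b. \<forall>x. M x b \<longleftrightarrow> M x a \<and> sat Q M (\<lambda>i. if i = 0 then x else e' (i - 1)) p"
    by (simp add: sat_formula[where v = undefined] holds_simps holds_plug cong: if_cong)
  have "case_nat x e' = (\<lambda>i. if i = 0 then x else e' (i - 1))" for x
    by (auto split: nat.split)
  then show ?thesis using * by simp
qed

text \<open>
  An element outside every class of a finite set of representatives comes from Russell's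
  paradox: pairing and union would collect the representatives in a universal set.
\<close>

lemma infinite_quotient:
  fixes Q M :: "nat \<Rightarrow> nat \<Rightarrow> bool"
  assumes equiv: "equivp Q"
    and cong: "\<And>i i' j j'. Q i i' \<Longrightarrow> Q j j' \<Longrightarrow> M i j \<Longrightarrow> M i' j'"
    and ZF: "\<And>p. p \<in> ZF \<Longrightarrow> sat Q M e p"
    and reps: "\<And>i. \<exists>j\<in>D. Q i j"
  shows "infinite D"
proof
  assume "finite D"
  have refl: "Q i i" for i using equiv by (rule equivp_reflp)
  have "sat Q M e ax_pairing" "sat Q M e ax_union" using ZF by (simp_all add: ZF_def)
  then have pairing: "\<exists>a. M x a \<and> M y a" and union: "\<exists>u. \<forall>z. M z u \<longleftrightarrow> (\<exists>x. M x a \<and> M z x)"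
    for x y a
    unfolding ax_pairing_def ax_union_def l_upair_def
    by (auto simp: sat_formula[where v = undefined] holds_simps) (metis refl)
  have "\<exists>b. \<forall>i\<in>D. M i b"
    using \<open>finite D\<close>
  proof (induction D rule: finite_induct)
    case (insert i F)
    then obtain b where b: "\<forall>j\<in>F. M j b" by blast
    obtain s where "M i s" using pairing by blast
    obtain t where "M b t" "M s t" using pairing by blast
    obtain u where "\<forall>z. M z u \<longleftrightarrow> (\<exists>x. M x t \<and> M z x)" using union by blast
    then have "\<forall>j\<in>insert i F. M j u" using b \<open>M i s\<close> \<open>M b t\<close> \<open>M s t\<close> by auto
    then show ?case by blast
  qed simp
  then obtain u where "\<forall>i\<in>D. M i u" by blast
  then have univ: "M i u" for i
    using reps[of i] cong refl equivp_symp[OF equiv] by blast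
  obtain b where "\<forall>x. M x b \<longleftrightarrow> M x u \<and> sat Q M (case_nat x e) (Imp (Mem 0 0) Fls)"
    using sat_separation[OF ZF] by blast
  then show False using univ by simp blast
qed

lemma sat_equiv_cong:
  assumes "equivp Q" "\<And>i i' j j'. Q i i' \<Longrightarrow> Q j j' \<Longrightarrow> M i j \<Longrightarrow> M i' j'"
  shows "(\<And>i. Q (e i) (e' i)) \<Longrightarrow> sat Q M e p = sat Q M e' p"
proof (induction p arbitrary: e e')
  case (Mem i j)
  then show ?case using assms equivp_symp[OF assms(1)] by (simp, blast)
next
  case (Eq i j)
  then have "Q (e i) = Q (e' i)" "Q (e j) = Q (e' j)"
    using assms(1) by (auto simp: equivp_def)
  then show ?case using assms(1) by (simp add: equivp_def)
next
  case (Univ p)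
  have "sat Q M (case_nat x e) p = sat Q M (case_nat x e') p" for x
    by (rule Univ.IH) (auto split: nat.split intro: Univ.prems equivp_reflp[OF assms(1)])
  then show ?case by simp
next
  case (Imp p q)
  have "sat Q M e p = sat Q M e' p" "sat Q M e q = sat Q M e' q" by (auto intro!: Imp)
  then show ?case by simp
qed simp

text \<open>Each \<open>Q\<close>-class is named by its least member. As there are infinitely many
  names, enumerating them puts the quotient on the whole type \<open>nat\<close>, where
  \<open>Q\<close> becomes true equality.\<close>

theorem ZF_model_existence:
  assumes "consistent G" "ZF \<subseteq> G"
  obtains M :: "nat \<Rightarrow> nat \<Rightarrow> bool" and e where "\<And>p. p \<in> G \<Longrightarrow> sat (=) M e p"
proof -
  obtain Q M :: "nat \<Rightarrow> nat \<Rightarrow> bool" and e where equiv: "equivp Q"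
    and cong: "\<And>i i' j j'. Q i i' \<Longrightarrow> Q j j' \<Longrightarrow> M i j \<Longrightarrow> M i' j'"
    and G: "\<And>p. p \<in> G \<Longrightarrow> sat Q M e p"
    using model_existence[OF assms(1)] by blast
  have sat_Q: "sat Q M e p = sat Q M e' p" if "\<And>i. Q (e i) (e' i)" for e e' p
    by (rule sat_equiv_cong[of Q M]) (use equiv cong that in blast)+
  define rep where "rep i = (LEAST j. Q i j)" for i
  have rep: "Q i (rep i)" for i
    unfolding rep_def by (rule LeastI[of _ i]) (rule equivp_reflp[OF equiv])
  have rep_eq: "rep i = rep j" if "Q i j" for i j
  proof -
    have "Q i = Q j" using equiv that by (simp add: equivp_def)
    then show ?thesis by (simp add: rep_def)
  qed
  define k where "k = enumerate (range rep)"
  have "infinite (range rep)"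
    by (rule infinite_quotient[of Q M e]) (use equiv cong G assms(2) rep in blast)+
  then have k: "inj k" "range k = range rep"
    using bij_enumerate unfolding k_def by (auto simp: bij_betw_def)
  have Q_k: "Q (k a) (k b) \<longleftrightarrow> a = b" for a b
  proof
    assume "Q (k a) (k b)"
    moreover obtain i j where "k a = rep i" "k b = rep j" using k(2) by (metis rangeE rangeI)
    moreover have "rep (rep i) = rep i" for i using rep rep_eq by metis
    ultimately have "k a = k b" using rep_eq by metis
    then show "a = b" using k(1) by (simp add: inj_eq)
  qed (simp add: equivp_reflp[OF equiv])
  have surj: "\<exists>a. Q i (k a)" for i using rep[of i] k(2) by (metis rangeE rangeI)
  define M' where "M' a b = M (k a) (k b)" for a b
  have sat: "sat (=) M' f p = sat Q M (\<lambda>i. k (f i)) p" for f p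
  proof (induction p arbitrary: f)
    case (Univ p)
    have shift: "(\<lambda>i. k (case_nat a f i)) = case_nat (k a) (\<lambda>i. k (f i))" for a
      by (auto split: nat.split)
    have "sat Q M (case_nat x (\<lambda>i. k (f i))) p"
      if *: "\<forall>a. sat Q M (case_nat (k a) (\<lambda>i. k (f i))) p" for x
    proof -
      obtain a where a: "Q x (k a)" using surj by blast
      have "sat Q M (case_nat x (\<lambda>i. k (f i))) p = sat Q M (case_nat (k a) (\<lambda>i. k (f i))) p"
        by (rule sat_Q)
          (auto split: nat.split simp: a equivp_reflp[OF equiv])
      then show ?thesis using * by simp
    qed
    then show ?case by (auto simp: Univ shift)
  qed (auto simp: M'_def Q_k)
  obtain f where f: "\<And>i. Q (e i) (k (f i))"
    using choice[of "\<lambda>i a. Q (e i) (k a)"] surj by blast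
  have "sat (=) M' f p" if "p \<in> G" for p
    unfolding sat using G[OF that] sat_Q[of e "\<lambda>i. k (f i)", OF f] by simp
  then show ?thesis using that by blast
qed

section \<open>Definability in a model of ZF\<close>

locale zf =
  fixes E :: "'a \<Rightarrow> 'a \<Rightarrow> bool"  (infix "\<epsilon>" 50) and e0 :: "nat \<Rightarrow> 'a"
  assumes ZF: "p \<in> ZF \<Longrightarrow> sat (=) E e0 p"
begin

text \<open>The environment of a defining formula has the arguments \<open>v\<close> at even and parameters at odd positions.\<close>

definition merge :: "(nat \<Rightarrow> 'a) \<Rightarrow> (nat \<Rightarrow> 'a) \<Rightarrow> nat \<Rightarrow> 'a" where
  "merge v w i = (if even i then v (i div 2) else w (i div 2))"

text \<open>The parameters \<open>w\<close> may be any elements of the model, so a predicate that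
  mentions a fixed graph, function or set is covered as it stands.\<close>

definition definable :: "((nat \<Rightarrow> 'a) \<Rightarrow> bool) \<Rightarrow> bool" where
  "definable P \<longleftrightarrow> (\<exists>p w. \<forall>v. P v = sat (=) E (merge v w) p)"

text \<open>In a language without function symbols, a term can be definable only through its
  graph.\<close>

definition dterm :: "((nat \<Rightarrow> 'a) \<Rightarrow> 'a) \<Rightarrow> bool" where
  "dterm f \<longleftrightarrow> definable (\<lambda>v. v 0 = f (\<lambda>i. v (Suc i)))"

section \<open>Closure properties of definability\<close>

named_theorems dfn

text \<open>\<open>B\<close> may be any HOL proposition, since a formula with the same truth value
  suffices.\<close>

lemma dfn_const [dfn]: "definable (\<lambda>v. B)"
proof (cases B)
  case True
  then show ?thesis unfolding definable_def by (intro exI[of _ "Imp Fls Fls"]) simp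
next
  case False
  then show ?thesis unfolding definable_def by (intro exI[of _ Fls]) simp
qed

text \<open>The two parameter sequences are interleaved into one. The renamings leave the arguments
  in place and send parameter \<open>k\<close> to slot \<open>2 * k\<close> for the first formula
  and to \<open>Suc (2 * k)\<close> for the second.\<close>

lemma dfn_imp [dfn]:
  assumes "definable P" "definable R"
  shows "definable (\<lambda>v. P v \<longrightarrow> R v)"
proof -
  obtain p w q u where P: "\<And>v. P v = sat (=) E (merge v w) p"
    and R: "\<And>v. R v = sat (=) E (merge v u) q"
    using assms unfolding definable_def by auto
  have "(\<lambda>i. merge v (merge w u) (if even i then i else Suc (2 * (2 * (i div 2))))) = merge v w"
    "(\<lambda>i. merge v (merge w u) (if even i then i else Suc (2 * Suc (2 * (i div 2))))) = merge v u"
    for v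
    by (auto simp: merge_def fun_eq_iff elim!: oddE)
  then have "(P v \<longrightarrow> R v) = sat (=) E (merge v (merge w u))
     (Imp (ren (\<lambda>i. if even i then i else Suc (2 * (2 * (i div 2)))) p)
          (ren (\<lambda>i. if even i then i else Suc (2 * Suc (2 * (i div 2)))) q))" for v
    by (simp add: P R sat_ren)
  then show ?thesis unfolding definable_def by blast
qed

lemma dfn_all [dfn]:
  assumes "definable (\<lambda>v. P (v 0) (\<lambda>i. v (Suc i)))"
  shows "definable (\<lambda>v. \<forall>x. P x v)"
proof -
  obtain p w where p: "\<And>v. P (v 0) (\<lambda>i. v (Suc i)) = sat (=) E (merge v w) p"
    using assms unfolding definable_def by auto
  \<comment> \<open>Argument 0 becomes the bound variable. At even \<open>i > 0\<close> stands an
    outer argument, found outside at \<open>i - 2\<close> and under the quantifier at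
    \<open>i - 1\<close>; a parameter moves from \<open>i\<close> to \<open>Suc i\<close>.\<close>
  let ?s = "\<lambda>i. if i = 0 then 0 else if even i then i - 1 else Suc i"
  have "(\<lambda>i. case_nat x (merge v w) (?s i)) = merge (case_nat x v) w" for x v
    by (auto simp: merge_def fun_eq_iff split: nat.split elim!: evenE oddE) (metis even_Suc dvd_triv_left)
  then have "(\<forall>x. P x v) = sat (=) E (merge v w) (Univ (ren ?s p))" for v
    using p[of "case_nat _ v"] by (simp add: sat_ren)
  then show ?thesis unfolding definable_def by blast
qed

lemma dfn_ren: "definable P \<Longrightarrow> definable (\<lambda>v. P (\<lambda>i. v (r i)))"
proof -
  assume "definable P"
  then obtain p w where p: "\<And>v. P v = sat (=) E (merge v w) p"
    unfolding definable_def by auto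
  let ?s = "\<lambda>i. if even i then 2 * r (i div 2) else i"
  have "(\<lambda>i. merge v w (?s i)) = merge (\<lambda>i. v (r i)) w" for v
    by (auto simp: merge_def fun_eq_iff)
  then have "P (\<lambda>i. v (r i)) = sat (=) E (merge v w) (ren ?s p)" for v
    by (simp add: p sat_ren)
  then show ?thesis unfolding definable_def by blast
qed

text \<open>Freezes all arguments but the first as parameters, because separation takes a predicate
  of one variable.\<close>

lemma dfn_param: "definable P \<Longrightarrow> definable (\<lambda>v. P (case_nat (v 0) u))"
proof -
  assume "definable P"
  then obtain p w where p: "\<And>v. P v = sat (=) E (merge v w) p"
    unfolding definable_def by auto
  \<comment> \<open>Frozen arguments go to the even parameter slots, the old parameters to the odd
    ones.\<close>
  let ?s = "\<lambda>i. if i = 0 then 0 else if even i then Suc (2 * (2 * (i div 2 - 1)))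
    else Suc (2 * Suc (2 * (i div 2)))"
  have "(\<lambda>i. merge v (merge u w) (?s i)) = merge (case_nat (v 0) u) w" for v
    by (auto simp: merge_def fun_eq_iff split: nat.split elim!: evenE oddE)
  then have "P (case_nat (v 0) u) = sat (=) E (merge v (merge u w)) (ren ?s p)" for v
    by (simp add: p sat_ren)
  then show ?thesis unfolding definable_def by blast
qed

lemma dfn_not [dfn]: "definable P \<Longrightarrow> definable (\<lambda>v. \<not> P v)"
  using dfn_imp[of P "\<lambda>_. False"] dfn_const by simp

lemma dfn_and [dfn]: "definable P \<Longrightarrow> definable R \<Longrightarrow> definable (\<lambda>v. P v \<and> R v)"
  using dfn_not[OF dfn_imp[OF _ dfn_not]] by simp

lemma dfn_or [dfn]: "definable P \<Longrightarrow> definable R \<Longrightarrow> definable (\<lambda>v. P v \<or> R v)"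
  using dfn_imp[OF dfn_not, of P R] by (simp add: disj_imp)

lemma dfn_iff [dfn]: "definable P \<Longrightarrow> definable R \<Longrightarrow> definable (\<lambda>v. P v \<longleftrightarrow> R v)"
  using dfn_and[OF dfn_imp dfn_imp, of P R R P] by (simp add: iff_conv_conj_imp)

lemma dfn_ex [dfn]:
  "definable (\<lambda>v. P (v 0) (\<lambda>i. v (Suc i))) \<Longrightarrow> definable (\<lambda>v. \<exists>x. P x v)"
  using dfn_not[OF dfn_all[of "\<lambda>x v. \<not> P x v"]] dfn_not by simp

lemma dfn_mem_var: "definable (\<lambda>v. v i \<epsilon> v j)"
  unfolding definable_def by (rule exI[of _ "Mem (2 * i) (2 * j)"]) (simp add: merge_def)

lemma dfn_eq_var: "definable (\<lambda>v. v i = v j)"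
  unfolding definable_def by (rule exI[of _ "Eq (2 * i) (2 * j)"]) (simp add: merge_def)

lemma dt_var [dfn]: "dterm (\<lambda>v. v i)"
  unfolding dterm_def by (rule dfn_eq_var)

lemma dt_const [dfn]: "dterm (\<lambda>v. c)"
  unfolding dterm_def definable_def
  by (rule exI[of _ "Eq 0 1"], rule exI[of _ "\<lambda>_. c"]) (simp add: merge_def)

lemma dt_ren: "dterm f \<Longrightarrow> dterm (\<lambda>v. f (\<lambda>i. v (r i)))"
  unfolding dterm_def using dfn_ren[of "\<lambda>v. v 0 = f (\<lambda>i. v (Suc i))" "case_nat 0 (\<lambda>i. Suc (r i))"]
  by simp

text \<open>The equivalent form \<open>\<exists>x. x = f v \<and> P x v\<close> mentions only the
  graph of \<open>f\<close>.\<close>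

lemma dfn_subst:
  assumes "definable (\<lambda>v. P (v 0) (\<lambda>i. v (Suc i)))" "dterm f"
  shows "definable (\<lambda>v. P (f v) v)"
proof -
  have "definable (\<lambda>v. \<exists>x. x = f v \<and> P x v)"
    using assms unfolding dterm_def by (intro dfn_ex dfn_and)
  then show ?thesis by simp
qed

text \<open>
  Arguments are substituted one at a time, always at position 0, which is why the variables appear
  in reverse order in the innermost goals.
\<close>

lemma dfn_subst1:
  "definable (\<lambda>v. P (v 0)) \<Longrightarrow> dterm f \<Longrightarrow> definable (\<lambda>v. P (f v))"
  using dfn_subst[of "\<lambda>x v. P x"] by simp

lemma dfn_subst2:
  assumes "definable (\<lambda>v. P (v 0) (v (Suc 0)))" "dterm f" "dterm g"
  shows "definable (\<lambda>v. P (f v) (g v))"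
proof (rule dfn_subst[OF _ assms(2)], rule dfn_subst[OF _ dt_ren[OF assms(3)]])
  show "definable (\<lambda>v. P (v (Suc 0)) (v 0))"
    using dfn_ren[OF assms(1), of "\<lambda>i. 1 - i"] by simp
qed

lemma dfn_subst3:
  assumes "definable (\<lambda>v. P (v 0) (v (Suc 0)) (v (Suc (Suc 0))))" "dterm f" "dterm g" "dterm h"
  shows "definable (\<lambda>v. P (f v) (g v) (h v))"
proof (rule dfn_subst[OF _ assms(2)], rule dfn_subst[OF _ dt_ren[OF assms(3)]],
    rule dfn_subst[OF _ dt_ren[OF assms(4)]])
  show "definable (\<lambda>v. P (v (Suc (Suc 0))) (v (Suc 0)) (v 0))"
    using dfn_ren[OF assms(1), of "\<lambda>i. 2 - i"] by (simp add: numeral_2_eq_2)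
qed

lemmas dfn_mem [dfn] = dfn_subst2[of "(\<epsilon>)", OF dfn_mem_var]
lemmas dfn_eq [dfn] = dfn_subst2[of "(=)", OF dfn_eq_var]

lemma dt_subst1:
  assumes "definable (\<lambda>v. v 0 = F (v (Suc 0)))" "dterm f"
  shows "dterm (\<lambda>v. F (f v))"
  unfolding dterm_def by (rule dfn_subst2[of "\<lambda>x y. x = F y", OF assms(1) dt_var dt_ren[OF assms(2)]])

lemma dt_subst2:
  assumes "definable (\<lambda>v. v 0 = F (v (Suc 0)) (v (Suc (Suc 0))))" "dterm f" "dterm g"
  shows "dterm (\<lambda>v. F (f v) (g v))"
  unfolding dterm_def by (rule dfn_subst3[of "\<lambda>x y z. x = F y z",
      OF assms(1) dt_var dt_ren[OF assms(2)] dt_ren[OF assms(3)]])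

lemma separation: "definable (\<lambda>v. P (v 0)) \<Longrightarrow> \<exists>b. \<forall>x. x \<epsilon> b \<longleftrightarrow> x \<epsilon> a \<and> P x"
proof -
  assume "definable (\<lambda>v. P (v 0))"
  then obtain p w where p: "\<And>v. P (v 0) = sat (=) E (merge v w) p"
    unfolding definable_def by auto
  \<comment> \<open>Arguments beyond the first do not affect \<open>P\<close>, so
    \<open>undefined\<close> can fill them.\<close>
  have "(\<lambda>i. case_nat x (merge undefined w) (if i = 0 then 0 else Suc i)) =
      merge (\<lambda>i. if i = 0 then x else undefined i) w" for x
    by (auto simp: merge_def fun_eq_iff)
  then have "P x = sat (=) E (case_nat x (merge undefined w)) (ren (\<lambda>i. if i = 0 then 0 else Suc i) p)"
    for x
    using p[of "\<lambda>i. if i = 0 then x else undefined i"] by (simp add: sat_ren)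
  then show ?thesis using sat_separation[OF ZF] by simp
qed

end

section \<open>Set theory in the model\<close>

context zf
begin

abbreviation dfn1 :: "('a \<Rightarrow> bool) \<Rightarrow> bool" where
  "dfn1 P \<equiv> definable (\<lambda>v. P (v 0))"

abbreviation dfn2 :: "('a \<Rightarrow> 'a \<Rightarrow> bool) \<Rightarrow> bool" where
  "dfn2 P \<equiv> definable (\<lambda>v. P (v 0) (v (Suc 0)))"

abbreviation dfn3 :: "('a \<Rightarrow> 'a \<Rightarrow> 'a \<Rightarrow> bool) \<Rightarrow> bool" where
  "dfn3 P \<equiv> definable (\<lambda>v. P (v 0) (v (Suc 0)) (v (Suc (Suc 0))))"

section \<open>Set formation from the axioms\<close>

lemma extensionality: "(\<And>z. z \<epsilon> x \<longleftrightarrow> z \<epsilon> y) \<Longrightarrow> x = y"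
proof -
  have "sat (=) E e0 ax_extensionality" by (rule ZF) (simp add: ZF_def)
  then show "(\<And>z. z \<epsilon> x \<longleftrightarrow> z \<epsilon> y) \<Longrightarrow> x = y"
    unfolding ax_extensionality_def
    by (simp add: sat_formula[where v = undefined] holds_simps)
qed

lemma foundation: "y \<epsilon> x \<Longrightarrow> \<exists>y. y \<epsilon> x \<and> \<not> (\<exists>z. z \<epsilon> x \<and> z \<epsilon> y)"
proof -
  have "sat (=) E e0 ax_foundation" by (rule ZF) (simp add: ZF_def)
  then show "y \<epsilon> x \<Longrightarrow> \<exists>y. y \<epsilon> x \<and> \<not> (\<exists>z. z \<epsilon> x \<and> z \<epsilon> y)"
    unfolding ax_foundation_def
    by (auto simp: sat_formula[where v = undefined] holds_simps)
qed

lemma set_ex1: "\<exists>b. \<forall>z. z \<epsilon> b \<longleftrightarrow> P z \<Longrightarrow> \<exists>!b. \<forall>z. z \<epsilon> b \<longleftrightarrow> P z"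
  by (auto intro: extensionality)

text \<open>Meaningful only when some set has exactly these members; each construction below draws
  this existence from an axiom or from separation.\<close>

definition collect :: "('a \<Rightarrow> bool) \<Rightarrow> 'a" where
  "collect P = (THE b. \<forall>z. z \<epsilon> b \<longleftrightarrow> P z)"

lemma mem_collect: "\<exists>b. \<forall>z. z \<epsilon> b \<longleftrightarrow> P z \<Longrightarrow> z \<epsilon> collect P \<longleftrightarrow> P z"
  unfolding collect_def using theI'[OF set_ex1, of P] by blast

definition sep :: "'a \<Rightarrow> ('a \<Rightarrow> bool) \<Rightarrow> 'a" where
  "sep a P = collect (\<lambda>x. x \<epsilon> a \<and> P x)"

lemma mem_sep: "dfn1 P \<Longrightarrow> z \<epsilon> sep a P \<longleftrightarrow> z \<epsilon> a \<and> P z"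
  unfolding sep_def by (rule mem_collect) (rule separation)

text \<open>By extensionality a value is determined by its members, so a definable membership
  condition yields a definable graph.\<close>

lemma dt_fun1:
  assumes "\<And>z x. z \<epsilon> F x \<longleftrightarrow> P z x" "dfn2 P" "dterm f"
  shows "dterm (\<lambda>v. F (f v))"
proof (rule dt_subst1[OF _ assms(3)])
  have "definable (\<lambda>v. \<forall>z. z \<epsilon> v 0 \<longleftrightarrow> P z (v (Suc 0)))"
    by (intro dfn dfn_subst2[OF assms(2)])
  moreover have "(x = F y) = (\<forall>z. z \<epsilon> x \<longleftrightarrow> P z y)" for x y
    using assms(1) extensionality by metis
  ultimately show "definable (\<lambda>v. v 0 = F (v (Suc 0)))" by simp
qed

lemma dt_fun2:
  assumes "\<And>z x y. z \<epsilon> F x y \<longleftrightarrow> P z x y" "dfn3 P" "dterm f" "dterm g"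
  shows "dterm (\<lambda>v. F (f v) (g v))"
proof (rule dt_subst2[OF _ assms(3,4)])
  have "definable (\<lambda>v. \<forall>z. z \<epsilon> v 0 \<longleftrightarrow> P z (v (Suc 0)) (v (Suc (Suc 0))))"
    by (intro dfn dfn_subst3[OF assms(2)])
  moreover have "(x = F y y') = (\<forall>z. z \<epsilon> x \<longleftrightarrow> P z y y')" for x y y'
    using assms(1) extensionality by metis
  ultimately show "definable (\<lambda>v. v 0 = F (v (Suc 0)) (v (Suc (Suc 0))))" by simp
qed

text \<open>The separating predicate may depend on the outer arguments. For each fixed
  \<open>u\<close> they are frozen as parameters, so that \<open>mem_sep\<close> applies.\<close>

lemma dt_sep [dfn]:
  assumes "dterm f" "definable (\<lambda>v. P (v 0) (\<lambda>i. v (Suc i)))"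
  shows "dterm (\<lambda>v. sep (f v) (\<lambda>x. P x v))"
proof -
  have "definable (\<lambda>v. P (v 0) (\<lambda>i. v (Suc (Suc i))))"
    using dfn_ren[OF assms(2), of "case_nat 0 (\<lambda>i. Suc (Suc i))"] by simp
  then have "definable (\<lambda>v. \<forall>z. z \<epsilon> v 0 \<longleftrightarrow> z \<epsilon> f (\<lambda>i. v (Suc i)) \<and> P z (\<lambda>i. v (Suc i)))"
    by (intro dfn dt_ren[OF assms(1)])
  moreover have "x = sep (f u) (\<lambda>x. P x u) \<longleftrightarrow> (\<forall>z. z \<epsilon> x \<longleftrightarrow> z \<epsilon> f u \<and> P z u)" for x u
    using mem_sep[of "\<lambda>x. P x u"] dfn_param[OF assms(2), of u] extensionality by simp metis
  ultimately show ?thesis unfolding dterm_def by simp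
qed

definition emp :: 'a where
  "emp = collect (\<lambda>z. False)"

definition upair :: "'a \<Rightarrow> 'a \<Rightarrow> 'a" where
  "upair x y = collect (\<lambda>z. z = x \<or> z = y)"

definition union :: "'a \<Rightarrow> 'a" where
  "union a = collect (\<lambda>z. \<exists>x. x \<epsilon> a \<and> z \<epsilon> x)"

definition subset :: "'a \<Rightarrow> 'a \<Rightarrow> bool" where
  "subset x y \<longleftrightarrow> (\<forall>z. z \<epsilon> x \<longrightarrow> z \<epsilon> y)"

definition pow :: "'a \<Rightarrow> 'a" where
  "pow a = collect (\<lambda>x. subset x a)"

definition ins :: "'a \<Rightarrow> 'a \<Rightarrow> 'a" where
  "ins x a = union (upair a (upair x x))"

definition un :: "'a \<Rightarrow> 'a \<Rightarrow> 'a" where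
  "un a b = union (upair a b)"

definition suc :: "'a \<Rightarrow> 'a" where
  "suc x = ins x x"

lemma mem_emp [simp]: "\<not> z \<epsilon> emp"
  unfolding emp_def using separation[OF dfn_const[of False]] by (subst mem_collect) auto

lemma mem_upair [simp]: "z \<epsilon> upair x y \<longleftrightarrow> z = x \<or> z = y"
proof -
  have "sat (=) E e0 ax_pairing" by (rule ZF) (simp add: ZF_def)
  then have "\<exists>a. \<forall>z. z \<epsilon> a \<longleftrightarrow> z = x \<or> z = y"
    unfolding ax_pairing_def l_upair_def
    by (simp add: sat_formula[where v = undefined] holds_simps)
  then show ?thesis unfolding upair_def by (rule mem_collect)
qed

lemma mem_union [simp]: "z \<epsilon> union a \<longleftrightarrow> (\<exists>x. x \<epsilon> a \<and> z \<epsilon> x)"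
proof -
  have "sat (=) E e0 ax_union" by (rule ZF) (simp add: ZF_def)
  then have "\<exists>u. \<forall>z. z \<epsilon> u \<longleftrightarrow> (\<exists>x. x \<epsilon> a \<and> z \<epsilon> x)"
    unfolding ax_union_def by (simp add: sat_formula[where v = undefined] holds_simps)
  then show ?thesis unfolding union_def by (rule mem_collect)
qed

lemma mem_pow [simp]: "x \<epsilon> pow a \<longleftrightarrow> subset x a"
proof -
  have "sat (=) E e0 ax_powerset" by (rule ZF) (simp add: ZF_def)
  then have "\<exists>u. \<forall>x. x \<epsilon> u \<longleftrightarrow> subset x a"
    unfolding ax_powerset_def l_subset_def subset_def
    by (simp add: sat_formula[where v = undefined] holds_simps)
  then show ?thesis unfolding pow_def by (rule mem_collect)
qed

lemma mem_ins [simp]: "z \<epsilon> ins x a \<longleftrightarrow> z = x \<or> z \<epsilon> a"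
  by (auto simp: ins_def)

lemma mem_un [simp]: "z \<epsilon> un a b \<longleftrightarrow> z \<epsilon> a \<or> z \<epsilon> b"
  by (auto simp: un_def)

lemma mem_suc [simp]: "z \<epsilon> suc x \<longleftrightarrow> z = x \<or> z \<epsilon> x"
  by (auto simp: suc_def)

lemma dfn_subset [dfn]: "dterm f \<Longrightarrow> dterm g \<Longrightarrow> definable (\<lambda>v. subset (f v) (g v))"
  by (rule dfn_subst2[of subset]; (assumption | (unfold subset_def, intro dfn)))

lemma dt_upair [dfn]: "dterm f \<Longrightarrow> dterm g \<Longrightarrow> dterm (\<lambda>v. upair (f v) (g v))"
  by (rule dt_fun2[OF mem_upair]) (intro dfn | assumption)+

lemma dt_union [dfn]: "dterm f \<Longrightarrow> dterm (\<lambda>v. union (f v))"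
  by (rule dt_fun1[OF mem_union]) (intro dfn | assumption)+

lemma dt_pow [dfn]: "dterm f \<Longrightarrow> dterm (\<lambda>v. pow (f v))"
  by (rule dt_fun1[OF mem_pow]) (intro dfn | assumption)+

lemma dt_ins [dfn]: "dterm f \<Longrightarrow> dterm g \<Longrightarrow> dterm (\<lambda>v. ins (f v) (g v))"
  by (rule dt_fun2[OF mem_ins]) (intro dfn | assumption)+

lemma dt_un [dfn]: "dterm f \<Longrightarrow> dterm g \<Longrightarrow> dterm (\<lambda>v. un (f v) (g v))"
  by (rule dt_fun2[OF mem_un]) (intro dfn | assumption)+

lemma dt_suc [dfn]: "dterm f \<Longrightarrow> dterm (\<lambda>v. suc (f v))"
  by (rule dt_fun1[OF mem_suc]) (intro dfn | assumption)+

section \<open>Ordered pairs, products and consequences of foundation\<close>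

definition pair :: "'a \<Rightarrow> 'a \<Rightarrow> 'a" where
  "pair x y = upair (upair x x) (upair x y)"

lemma dt_pair [dfn]: "dterm f \<Longrightarrow> dterm g \<Longrightarrow> dterm (\<lambda>v. pair (f v) (g v))"
  unfolding pair_def by (intro dfn)

lemma pair_inject [simp]: "pair x y = pair x' y' \<longleftrightarrow> x = x' \<and> y = y'"
proof
  assume *: "pair x y = pair x' y'"
  have eq: "z \<epsilon> pair x y \<longleftrightarrow> z = upair x x \<or> z = upair x y" for z x y
    by (simp add: pair_def)
  have up: "upair a b = upair c d \<longleftrightarrow> (a = c \<and> b = d) \<or> (a = d \<and> b = c)" for a b c d
  proof
    assume "upair a b = upair c d"
    then have "z = a \<or> z = b \<longleftrightarrow> z = c \<or> z = d" for z by (metis mem_upair)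
    then show "a = c \<and> b = d \<or> a = d \<and> b = c" by metis
  next
    assume "a = c \<and> b = d \<or> a = d \<and> b = c"
    then show "upair a b = upair c d" by (intro extensionality) auto
  qed
  show "x = x' \<and> y = y'"
    using eq[of _ x y] eq[of _ x' y'] unfolding * by (metis up)
qed simp

definition prod :: "'a \<Rightarrow> 'a \<Rightarrow> 'a" where
  "prod a b = sep (pow (pow (un a b))) (\<lambda>p. \<exists>x y. x \<epsilon> a \<and> y \<epsilon> b \<and> p = pair x y)"

lemma dt_prod [dfn]: "dterm f \<Longrightarrow> dterm g \<Longrightarrow> dterm (\<lambda>v. prod (f v) (g v))"
proof (rule dt_subst2[of prod])
  show "definable (\<lambda>v. v 0 = prod (v (Suc 0)) (v (Suc (Suc 0))))"
    unfolding prod_def by (intro dfn)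
qed

lemma mem_prod: "p \<epsilon> prod a b \<longleftrightarrow> (\<exists>x y. x \<epsilon> a \<and> y \<epsilon> b \<and> p = pair x y)"
proof -
  have "pair x y \<epsilon> pow (pow (un a b))" if "x \<epsilon> a" "y \<epsilon> b" for x y
    using that by (auto simp: pair_def subset_def)
  moreover have "p \<epsilon> prod a b \<longleftrightarrow>
      p \<epsilon> pow (pow (un a b)) \<and> (\<exists>x y. x \<epsilon> a \<and> y \<epsilon> b \<and> p = pair x y)"
    unfolding prod_def by (rule mem_sep) (intro dfn)
  ultimately show ?thesis by blast
qed

lemma pair_mem_prod [simp]: "pair x y \<epsilon> prod a b \<longleftrightarrow> x \<epsilon> a \<and> y \<epsilon> b"
  by (auto simp: mem_prod)

lemma not_mem_self [simp]: "\<not> x \<epsilon> x"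
  using foundation[of x "upair x x"] by auto

lemma not_mem_mem: "x \<epsilon> y \<Longrightarrow> \<not> y \<epsilon> x"
  using foundation[of x "upair x y"] by auto

text \<open>Foundation excludes membership cycles of length two, so injectivity holds for all sets
  and not only for natural numbers.\<close>

lemma suc_inject [simp]: "suc x = suc y \<longleftrightarrow> x = y"
proof
  assume "suc x = suc y"
  then have "x \<epsilon> suc y" "y \<epsilon> suc x" by (metis mem_suc)+
  then show "x = y" using not_mem_mem by auto
qed simp

lemma suc_neq_emp [simp]: "suc x \<noteq> emp" "emp \<noteq> suc x"
  by (metis mem_suc mem_emp)+

subsection \<open>Natural numbers\<close>

definition ind :: "'a \<Rightarrow> bool" where
  "ind a \<longleftrightarrow> emp \<epsilon> a \<and> (\<forall>x. x \<epsilon> a \<longrightarrow> suc x \<epsilon> a)"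

lemma dfn_ind [dfn]: "dterm f \<Longrightarrow> definable (\<lambda>v. ind (f v))"
  by (rule dfn_subst1[of ind]; (assumption | (unfold ind_def, intro dfn)))

definition om :: 'a where
  "om = collect (\<lambda>n. \<forall>a. ind a \<longrightarrow> n \<epsilon> a)"

lemma empty_iff: "(\<forall>z. \<not> z \<epsilon> x) \<longleftrightarrow> x = emp"
  using extensionality[of x emp] by auto

lemma suc_iff: "(\<forall>z. z \<epsilon> y \<longleftrightarrow> z \<epsilon> x \<or> z = x) \<longleftrightarrow> y = suc x"
  using extensionality[of y "suc x"] by auto

lemma mem_om: "n \<epsilon> om \<longleftrightarrow> (\<forall>a. ind a \<longrightarrow> n \<epsilon> a)"
proof -
  have "sat (=) E e0 ax_infinity" by (rule ZF) (simp add: ZF_def)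
  then obtain a where a: "ind a"
    unfolding ax_infinity_def l_inductive_def l_empty_def l_succ_def ind_def
    by (auto simp: sat_formula[where v = undefined] holds_simps empty_iff suc_iff)
  have "\<exists>b. \<forall>x. x \<epsilon> b \<longleftrightarrow> x \<epsilon> a \<and> (\<forall>a. ind a \<longrightarrow> x \<epsilon> a)"
    by (rule separation) (intro dfn)
  then have "\<exists>b. \<forall>x. x \<epsilon> b \<longleftrightarrow> (\<forall>a. ind a \<longrightarrow> x \<epsilon> a)" using a by metis
  then show ?thesis unfolding om_def by (rule mem_collect)
qed

lemma emp_om [simp]: "emp \<epsilon> om"
  by (simp add: mem_om ind_def)

lemma suc_om: "n \<epsilon> om \<Longrightarrow> suc n \<epsilon> om"
  by (simp add: mem_om ind_def)

text \<open>The \<open>om\<close> of the model may contain nonstandard elements, so induction on HOL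
  naturals is no substitute: \<open>P\<close> has to cut an inductive set out of
  \<open>om\<close>.\<close>

lemma om_induct:
  assumes "n \<epsilon> om" "dfn1 P" "P emp" "\<And>n. n \<epsilon> om \<Longrightarrow> P n \<Longrightarrow> P (suc n)"
  shows "P n"
proof -
  have "ind (sep om P)" using assms(2-4) by (simp add: ind_def mem_sep suc_om)
  then have "n \<epsilon> sep om P" using assms(1) mem_om by blast
  then show ?thesis using assms(2) by (simp add: mem_sep)
qed

lemma om_cases:
  assumes "n \<epsilon> om" obtains "n = emp" | m where "m \<epsilon> om" "n = suc m"
proof -
  have "n = emp \<or> (\<exists>m. m \<epsilon> om \<and> n = suc m)"
    using assms by (rule om_induct) (auto intro!: dfn)
  then show ?thesis using that by blast
qed

lemma om_trans: "m \<epsilon> n \<Longrightarrow> n \<epsilon> om \<Longrightarrow> m \<epsilon> om"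
proof -
  assume "m \<epsilon> n" "n \<epsilon> om"
  have "\<forall>m. m \<epsilon> n \<longrightarrow> m \<epsilon> om"
    using \<open>n \<epsilon> om\<close> by (rule om_induct) (auto intro!: dfn)
  then show ?thesis using \<open>m \<epsilon> n\<close> by blast
qed

lemma nat_trans: "k \<epsilon> m \<Longrightarrow> m \<epsilon> n \<Longrightarrow> n \<epsilon> om \<Longrightarrow> k \<epsilon> n"
proof -
  assume *: "k \<epsilon> m" "m \<epsilon> n" "n \<epsilon> om"
  have "\<forall>m k. m \<epsilon> n \<longrightarrow> k \<epsilon> m \<longrightarrow> k \<epsilon> n"
    using \<open>n \<epsilon> om\<close> by (rule om_induct) (auto intro!: dfn)
  then show ?thesis using * by blast
qed

lemma emp_mem_suc: "n \<epsilon> om \<Longrightarrow> emp \<epsilon> suc n"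
  by (erule om_induct) (auto intro!: dfn)

lemma suc_mem_suc: "n \<epsilon> om \<Longrightarrow> m \<epsilon> n \<Longrightarrow> suc m \<epsilon> suc n"
proof -
  assume *: "n \<epsilon> om" "m \<epsilon> n"
  have "\<forall>m. m \<epsilon> n \<longrightarrow> suc m \<epsilon> suc n"
    using \<open>n \<epsilon> om\<close> by (rule om_induct) (auto intro!: dfn)
  then show ?thesis using * by blast
qed

text \<open>Induction on \<open>n\<close> for all \<open>m\<close> at once. A nonzero
  \<open>m\<close> is a successor, and comparing its predecessor with \<open>n\<close> settles the
  step.\<close>

lemma nat_linear: "m \<epsilon> om \<Longrightarrow> n \<epsilon> om \<Longrightarrow> m \<epsilon> n \<or> m = n \<or> n \<epsilon> m"
proof -
  assume *: "m \<epsilon> om" "n \<epsilon> om"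
  have "\<forall>m. m \<epsilon> om \<longrightarrow> m \<epsilon> n \<or> m = n \<or> n \<epsilon> m"
    using \<open>n \<epsilon> om\<close>
  proof (rule om_induct)
    show "dfn1 (\<lambda>n. \<forall>m. m \<epsilon> om \<longrightarrow> m \<epsilon> n \<or> m = n \<or> n \<epsilon> m)" by (intro dfn)
    show "\<forall>m. m \<epsilon> om \<longrightarrow> m \<epsilon> emp \<or> m = emp \<or> emp \<epsilon> m"
      using emp_mem_suc om_cases by metis
    show "\<forall>m. m \<epsilon> om \<longrightarrow> m \<epsilon> suc n \<or> m = suc n \<or> suc n \<epsilon> m"
      if "n \<epsilon> om" and IH: "\<forall>m. m \<epsilon> om \<longrightarrow> m \<epsilon> n \<or> m = n \<or> n \<epsilon> m" for n
    proof (intro allI impI)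
      fix m assume "m \<epsilon> om"
      then show "m \<epsilon> suc n \<or> m = suc n \<or> suc n \<epsilon> m"
      proof (cases rule: om_cases)
        case 1
        then show ?thesis using emp_mem_suc \<open>n \<epsilon> om\<close> by simp
      next
        case (2 k)
        then have "k \<epsilon> n \<or> k = n \<or> n \<epsilon> k"
          using IH \<open>m \<epsilon> om\<close> om_trans[of k m] by (metis mem_suc)
        then show ?thesis using 2 suc_mem_suc \<open>n \<epsilon> om\<close> by auto
      qed
    qed
  qed
  then show ?thesis using * by blast
qed

text \<open>Foundation, applied to the set of members of \<open>a\<close> that satisfy
  \<open>P\<close>, yields an \<epsilon>-minimal one.\<close>

lemma least_mem: "dfn1 P \<Longrightarrow> x \<epsilon> a \<Longrightarrow> P x \<Longrightarrow>
    \<exists>m. m \<epsilon> a \<and> P m \<and> (\<forall>k. k \<epsilon> m \<longrightarrow> k \<epsilon> a \<longrightarrow> \<not> P k)"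
  using foundation[of x "sep a P"] by (auto simp: mem_sep)

lemma nat_least: "dfn1 P \<Longrightarrow> n \<epsilon> om \<Longrightarrow> P n \<Longrightarrow>
    \<exists>m. m \<epsilon> om \<and> P m \<and> (\<forall>k. k \<epsilon> m \<longrightarrow> \<not> P k)"
  using least_mem[of P n om] om_trans by meson

subsection \<open>Functions and finite sets\<close>

definition isfun :: "'a \<Rightarrow> 'a \<Rightarrow> 'a \<Rightarrow> bool" where
  "isfun f a b \<longleftrightarrow>
     (\<forall>p. p \<epsilon> f \<longrightarrow> (\<exists>x y. x \<epsilon> a \<and> y \<epsilon> b \<and> p = pair x y)) \<and>
     (\<forall>x. x \<epsilon> a \<longrightarrow> (\<exists>y. pair x y \<epsilon> f \<and> (\<forall>z. pair x z \<epsilon> f \<longrightarrow> z = y)))"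

definition injective :: "'a \<Rightarrow> bool" where
  "injective f \<longleftrightarrow> (\<forall>x y z. pair x z \<epsilon> f \<and> pair y z \<epsilon> f \<longrightarrow> x = y)"

definition onto :: "'a \<Rightarrow> 'a \<Rightarrow> bool" where
  "onto f b \<longleftrightarrow> (\<forall>y. y \<epsilon> b \<longrightarrow> (\<exists>x. pair x y \<epsilon> f))"

definition eqp :: "'a \<Rightarrow> 'a \<Rightarrow> bool" where
  "eqp a b \<longleftrightarrow> (\<exists>f. isfun f a b \<and> injective f \<and> onto f b)"

definition Fin :: "'a \<Rightarrow> bool" where
  "Fin a \<longleftrightarrow> (\<exists>n. n \<epsilon> om \<and> eqp a n)"

lemma dfn_isfun [dfn]:
  "dterm f \<Longrightarrow> dterm g \<Longrightarrow> dterm h \<Longrightarrow> definable (\<lambda>v. isfun (f v) (g v) (h v))"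
  by (rule dfn_subst3[of isfun]; (assumption | (unfold isfun_def, intro dfn)))

lemma dfn_injective [dfn]: "dterm f \<Longrightarrow> definable (\<lambda>v. injective (f v))"
  by (rule dfn_subst1[of injective]; (assumption | (unfold injective_def, intro dfn)))

lemma dfn_onto [dfn]: "dterm f \<Longrightarrow> dterm g \<Longrightarrow> definable (\<lambda>v. onto (f v) (g v))"
  by (rule dfn_subst2[of onto]; (assumption | (unfold onto_def, intro dfn)))

lemma dfn_eqp [dfn]: "dterm f \<Longrightarrow> dterm g \<Longrightarrow> definable (\<lambda>v. eqp (f v) (g v))"
  by (rule dfn_subst2[of eqp]; (assumption | (unfold eqp_def, intro dfn)))

lemma dfn_Fin [dfn]: "dterm f \<Longrightarrow> definable (\<lambda>v. Fin (f v))"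
  by (rule dfn_subst1[of Fin]; (assumption | (unfold Fin_def, intro dfn)))

lemma isfun_memD: "isfun f a b \<Longrightarrow> pair x y \<epsilon> f \<Longrightarrow> x \<epsilon> a \<and> y \<epsilon> b"
  unfolding isfun_def by (metis pair_inject)

lemma isfun_unique: "isfun f a b \<Longrightarrow> pair x y \<epsilon> f \<Longrightarrow> pair x z \<epsilon> f \<Longrightarrow> y = z"
proof -
  assume f: "isfun f a b" "pair x y \<epsilon> f" "pair x z \<epsilon> f"
  then have "x \<epsilon> a" using isfun_memD by blast
  then obtain u where "\<forall>z. pair x z \<epsilon> f \<longrightarrow> z = u" using f(1) unfolding isfun_def by blast
  then show ?thesis using f by blast
qed

lemma isfun_ex: "isfun f a b \<Longrightarrow> x \<epsilon> a \<Longrightarrow> \<exists>y. pair x y \<epsilon> f"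
  unfolding isfun_def by blast

text \<open>Turns a definable relation into a function that is a set of the model, cut out of
  \<open>prod a b\<close> by separation.\<close>

lemma function_from_relation:
  assumes "dfn2 R"
    and total: "\<And>x. x \<epsilon> a \<Longrightarrow> \<exists>y. y \<epsilon> b \<and> R x y"
    and unique: "\<And>x y z. x \<epsilon> a \<Longrightarrow> y \<epsilon> b \<Longrightarrow> z \<epsilon> b \<Longrightarrow> R x y \<Longrightarrow> R x z \<Longrightarrow> y = z"
  obtains f where "isfun f a b" "\<And>x y. pair x y \<epsilon> f \<longleftrightarrow> x \<epsilon> a \<and> y \<epsilon> b \<and> R x y"
proof -
  define f where "f = sep (prod a b) (\<lambda>p. \<exists>x y. p = pair x y \<and> R x y)"
  have f: "p \<epsilon> f \<longleftrightarrow> p \<epsilon> prod a b \<and> (\<exists>x y. p = pair x y \<and> R x y)" for p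
    unfolding f_def by (rule mem_sep) (intro dfn dfn_subst2[OF assms(1)])
  then have mem: "pair x y \<epsilon> f \<longleftrightarrow> x \<epsilon> a \<and> y \<epsilon> b \<and> R x y" for x y by auto
  have "isfun f a b"
    unfolding isfun_def
  proof (intro conjI allI impI)
    show "\<exists>x y. x \<epsilon> a \<and> y \<epsilon> b \<and> p = pair x y" if "p \<epsilon> f" for p
      using that f mem_prod by blast
    show "\<exists>y. pair x y \<epsilon> f \<and> (\<forall>z. pair x z \<epsilon> f \<longrightarrow> z = y)" if "x \<epsilon> a" for x
      using total[OF that] unique[OF that] mem that by metis
  qed
  then show ?thesis using that mem by blast
qed

lemma eqpI:
  assumes "dfn2 R"
    and "\<And>x. x \<epsilon> a \<Longrightarrow> \<exists>y. y \<epsilon> b \<and> R x y"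
    and "\<And>x y z. x \<epsilon> a \<Longrightarrow> y \<epsilon> b \<Longrightarrow> z \<epsilon> b \<Longrightarrow> R x y \<Longrightarrow> R x z \<Longrightarrow> y = z"
    and "\<And>x y z. x \<epsilon> a \<Longrightarrow> y \<epsilon> a \<Longrightarrow> z \<epsilon> b \<Longrightarrow> R x z \<Longrightarrow> R y z \<Longrightarrow> x = y"
    and "\<And>y. y \<epsilon> b \<Longrightarrow> \<exists>x. x \<epsilon> a \<and> R x y"
  shows "eqp a b"
proof -
  obtain f where "isfun f a b" and f: "\<And>x y. pair x y \<epsilon> f \<longleftrightarrow> x \<epsilon> a \<and> y \<epsilon> b \<and> R x y"
    by (rule function_from_relation[OF assms(1)]) (use assms(2,3) in blast)+
  moreover have "injective f" "onto f b"
    using assms(4,5) f unfolding injective_def onto_def by blast+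
  ultimately show ?thesis unfolding eqp_def by blast
qed

lemma injectiveD: "injective f \<Longrightarrow> pair x z \<epsilon> f \<Longrightarrow> pair y z \<epsilon> f \<Longrightarrow> x = y"
  unfolding injective_def by blast

lemma ontoD: "onto f b \<Longrightarrow> y \<epsilon> b \<Longrightarrow> \<exists>x. pair x y \<epsilon> f"
  unfolding onto_def by blast

section \<open>Closure properties of finite sets\<close>

lemma Fin_emp [simp]: "Fin emp"
proof -
  have "eqp emp emp" by (rule eqpI[of "\<lambda>_ _. False"]) (auto intro: dfn)
  then show ?thesis unfolding Fin_def using emp_om by blast
qed

lemma ins_absorb: "x \<epsilon> a \<Longrightarrow> ins x a = a"
  by (rule extensionality) auto

lemma Fin_ins: "Fin a \<Longrightarrow> Fin (ins x a)"
proof (cases "x \<epsilon> a")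
  case False
  assume "Fin a"
  then obtain n where n: "n \<epsilon> om" "eqp a n" unfolding Fin_def by blast
  from n(2) obtain f where f: "isfun f a n" "injective f" "onto f n" unfolding eqp_def by blast
  note f = isfun_memD[OF f(1)] isfun_ex[OF f(1)] isfun_unique[OF f(1)] injectiveD[OF f(2)] ontoD[OF f(3)]
  have "eqp (ins x a) (suc n)"
  proof (rule eqpI[of "\<lambda>u m. pair u m \<epsilon> f \<or> u = x \<and> m = n"])
    show "dfn2 (\<lambda>u m. pair u m \<epsilon> f \<or> u = x \<and> m = n)" by (intro dfn)
  next
    fix y assume "y \<epsilon> ins x a"
    then have "y = x \<or> y \<epsilon> a" by simp
    then show "\<exists>m. m \<epsilon> suc n \<and> (pair y m \<epsilon> f \<or> y = x \<and> m = n)"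
      using f(1,2) mem_suc by blast
  next
    fix m assume "m \<epsilon> suc n"
    then have "m = n \<or> m \<epsilon> n" by simp
    then show "\<exists>y. y \<epsilon> ins x a \<and> (pair y m \<epsilon> f \<or> y = x \<and> m = n)"
      using f(1,5) mem_ins by blast
  next
    fix u m m' assume "pair u m \<epsilon> f \<or> u = x \<and> m = n" "pair u m' \<epsilon> f \<or> u = x \<and> m' = n"
    then show "m = m'" using f(1,3) False by blast
  next
    fix u u' m assume "pair u m \<epsilon> f \<or> u = x \<and> m = n" "pair u' m \<epsilon> f \<or> u' = x \<and> m = n"
    then show "u = u'" using f(1,4) not_mem_self by blast
  qed
  then show ?thesis unfolding Fin_def using suc_om n(1) by blast
qed (simp add: ins_absorb)

text \<open>Internal induction on the size \<open>n\<close>, over all sets of that size at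
  once.\<close>

lemma Fin_induct:
  assumes "Fin a" "dfn1 P" "P emp" "\<And>a x. P a \<Longrightarrow> \<not> x \<epsilon> a \<Longrightarrow> P (ins x a)"
  shows "P a"
proof -
  obtain n where n: "n \<epsilon> om" "eqp a n" using assms(1) unfolding Fin_def by blast
  have "\<forall>a. eqp a n \<longrightarrow> P a"
    using n(1)
  proof (rule om_induct)
    show "dfn1 (\<lambda>n. \<forall>a. eqp a n \<longrightarrow> P a)" by (intro dfn dfn_subst1[OF assms(2)])
    show "\<forall>a. eqp a emp \<longrightarrow> P a"
    proof (intro allI impI)
      fix a assume "eqp a emp"
      then have "\<forall>z. \<not> z \<epsilon> a" unfolding eqp_def by (metis isfun_ex isfun_memD mem_emp)
      then show "P a" using assms(3) by (simp add: empty_iff)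
    qed
    fix n assume "n \<epsilon> om" and IH: "\<forall>a. eqp a n \<longrightarrow> P a"
    show "\<forall>a. eqp a (suc n) \<longrightarrow> P a"
    proof (intro allI impI)
      fix a assume "eqp a (suc n)"
      then obtain f where f: "isfun f a (suc n)" "injective f" "onto f (suc n)"
        unfolding eqp_def by blast
      note f = isfun_memD[OF f(1)] isfun_ex[OF f(1)] isfun_unique[OF f(1)] 
        injectiveD[OF f(2)] ontoD[OF f(3)]
      \<comment> \<open>\<open>x\<close> is the element numbered by the last number
        \<open>n\<close>; on the remaining elements the same \<open>f\<close> is a bijection onto
        \<open>n\<close>.\<close>
      obtain x where x: "pair x n \<epsilon> f" using f(5)[of n] by auto
      let ?a = "sep a (\<lambda>y. y \<noteq> x)"
      have mem: "y \<epsilon> ?a \<longleftrightarrow> y \<epsilon> a \<and> y \<noteq> x" for y by (rule mem_sep) (intro dfn)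
      have "eqp ?a n"
      proof (rule eqpI[of "\<lambda>y m. pair y m \<epsilon> f"])
        show "dfn2 (\<lambda>y m. pair y m \<epsilon> f)" by (intro dfn)
        show "\<exists>m. m \<epsilon> n \<and> pair y m \<epsilon> f" if "y \<epsilon> ?a" for y
          using that mem f(1,2,4) x by (metis mem_suc)
        show "\<exists>y. y \<epsilon> ?a \<and> pair y m \<epsilon> f" if "m \<epsilon> n" for m
          using that mem f(1,3,5) x by (metis mem_suc not_mem_self)
      qed (use f(3,4) in blast)+
      then have "P (ins x ?a)" using IH assms(4) mem by blast
      moreover have "ins x ?a = a" using mem x f(1) by (intro extensionality) auto
      ultimately show "P a" by simp
    qed
  qed
  then show ?thesis using n(2) by blast
qed

lemma Fin_subset: "Fin a \<Longrightarrow> (\<And>x. x \<epsilon> b \<Longrightarrow> x \<epsilon> a) \<Longrightarrow> Fin b"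
proof -
  assume "Fin a" and sub: "\<And>x. x \<epsilon> b \<Longrightarrow> x \<epsilon> a"
  have "\<forall>b. subset b a \<longrightarrow> Fin b"
    using \<open>Fin a\<close>
  proof (rule Fin_induct)
    show "dfn1 (\<lambda>a. \<forall>b. subset b a \<longrightarrow> Fin b)" by (intro dfn)
    show "\<forall>b. subset b emp \<longrightarrow> Fin b"
      using empty_iff by (metis subset_def mem_emp Fin_emp)
    fix a x assume IH: "\<forall>b. subset b a \<longrightarrow> Fin b"
    show "\<forall>b. subset b (ins x a) \<longrightarrow> Fin b"
    proof (intro allI impI)
      fix b assume b: "subset b (ins x a)"
      let ?c = "sep b (\<lambda>y. y \<noteq> x)"
      have mem: "y \<epsilon> ?c \<longleftrightarrow> y \<epsilon> b \<and> y \<noteq> x" for y by (rule mem_sep) (intro dfn)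
      have "Fin ?c" using IH b mem by (auto simp: subset_def)
      moreover have "b = (if x \<epsilon> b then ins x ?c else ?c)"
        by (rule extensionality) (auto simp: mem)
      ultimately show "Fin b" using Fin_ins by metis
    qed
  qed
  then show ?thesis using sub by (auto simp: subset_def)
qed

lemma Fin_un: "Fin a \<Longrightarrow> Fin b \<Longrightarrow> Fin (un a b)"
proof -
  assume "Fin a" and "Fin b"
  from \<open>Fin a\<close> show "Fin (un a b)"
  proof (rule Fin_induct[where P = "\<lambda>a. Fin (un a b)"])
    show "dfn1 (\<lambda>a. Fin (un a b))" by (intro dfn)
    have "un emp b = b" by (rule extensionality) simp
    then show "Fin (un emp b)" using \<open>Fin b\<close> by simp
    have "un (ins x a) b = ins x (un a b)" for a x by (rule extensionality) auto
    then show "Fin (un a b) \<Longrightarrow> Fin (un (ins x a) b)" for a x by (simp add: Fin_ins)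
  qed
qed

lemma Fin_union: "Fin c \<Longrightarrow> (\<And>x. x \<epsilon> c \<Longrightarrow> Fin x) \<Longrightarrow> Fin (union c)"
proof -
  assume "Fin c" and Fin: "\<And>x. x \<epsilon> c \<Longrightarrow> Fin x"
  have "(\<forall>x. x \<epsilon> c \<longrightarrow> Fin x) \<longrightarrow> Fin (union c)"
    using \<open>Fin c\<close>
  proof (rule Fin_induct)
    show "dfn1 (\<lambda>c. (\<forall>x. x \<epsilon> c \<longrightarrow> Fin x) \<longrightarrow> Fin (union c))" by (intro dfn)
    have "union emp = emp" by (rule extensionality) simp
    then show "(\<forall>x. x \<epsilon> emp \<longrightarrow> Fin x) \<longrightarrow> Fin (union emp)" by simp
    have "union (ins x a) = un x (union a)" for a x by (rule extensionality) auto
    then show "(\<forall>y. y \<epsilon> a \<longrightarrow> Fin y) \<longrightarrow> Fin (union a) \<Longrightarrow>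
      (\<forall>y. y \<epsilon> ins x a \<longrightarrow> Fin y) \<longrightarrow> Fin (union (ins x a))" for a x
      by (simp add: Fin_un)
  qed
  then show ?thesis using Fin by blast
qed

text \<open>\<open>R\<close> is a definable relation instead of a function that is a set. In the
  induction on \<open>a\<close>, the new element \<open>x\<close> accounts for at most one element
  of \<open>c\<close>.\<close>

lemma Fin_image:
  assumes "Fin a" "dfn2 R" "\<And>x y z. x \<epsilon> a \<Longrightarrow> R x y \<Longrightarrow> R x z \<Longrightarrow> y = z"
    and "\<And>y. y \<epsilon> c \<Longrightarrow> \<exists>x. x \<epsilon> a \<and> R x y"
  shows "Fin c"
proof -
  have "\<forall>c. (\<forall>x y z. x \<epsilon> a \<longrightarrow> R x y \<longrightarrow> R x z \<longrightarrow> y = z) \<longrightarrow>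
      (\<forall>y. y \<epsilon> c \<longrightarrow> (\<exists>x. x \<epsilon> a \<and> R x y)) \<longrightarrow> Fin c" (is "?P a")
    using assms(1)
  proof (rule Fin_induct)
    show "dfn1 ?P" by (intro dfn dfn_subst2[OF assms(2)])
    show "?P emp" using Fin_emp empty_iff by (metis mem_emp)
    fix a x assume IH: "?P a"
    show "?P (ins x a)"
    proof (intro allI impI)
      fix c assume unique: "\<forall>u y z. u \<epsilon> ins x a \<longrightarrow> R u y \<longrightarrow> R u z \<longrightarrow> y = z"
        and c: "\<forall>y. y \<epsilon> c \<longrightarrow> (\<exists>u. u \<epsilon> ins x a \<and> R u y)"
      let ?c = "sep c (\<lambda>y. \<not> R x y)"
      have mem: "y \<epsilon> ?c \<longleftrightarrow> y \<epsilon> c \<and> \<not> R x y" for y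
        by (rule mem_sep) (intro dfn dfn_subst2[OF assms(2)])
      have "Fin ?c" using IH unique c mem by (metis mem_ins)
      moreover have "c = ?c \<or> (\<exists>y. c = ins y ?c)"
      proof (cases "\<exists>y. y \<epsilon> c \<and> R x y")
        case True
        then obtain y where y: "y \<epsilon> c" "R x y" by blast
        have "c = ins y ?c"
          using y unique mem by (intro extensionality) (metis mem_ins)
        then show ?thesis by blast
      next
        case False
        then have "c = ?c" using mem by (intro extensionality) blast
        then show ?thesis by blast
      qed
      ultimately show "Fin c" using Fin_ins by metis
    qed
  qed
  then show ?thesis using assms(3,4) by blast
qed

text \<open>The subsets of \<open>ins x a\<close> without \<open>x\<close> are the subsets of
  \<open>a\<close>; those with \<open>x\<close> arise from subsets of \<open>a\<close> by
  \<open>ins x\<close>.\<close>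

lemma Fin_pow: "Fin a \<Longrightarrow> Fin (pow a)"
proof (erule Fin_induct)
  show "dfn1 (\<lambda>a. Fin (pow a))" by (intro dfn)
  have "pow emp = ins emp emp"
    using empty_iff by (intro extensionality) (simp add: subset_def)
  then show "Fin (pow emp)" by (simp add: Fin_ins)
next
  fix a x assume "Fin (pow a)" "\<not> x \<epsilon> a"
  let ?c = "sep (pow (ins x a)) (\<lambda>b. x \<epsilon> b)"
  have mem: "b \<epsilon> ?c \<longleftrightarrow> subset b (ins x a) \<and> x \<epsilon> b" for b
    by (subst mem_sep) (auto intro!: dfn)
  have "Fin ?c"
  proof (rule Fin_image[of "pow a" "\<lambda>b c. c = ins x b", OF \<open>Fin (pow a)\<close>])
    show "dfn2 (\<lambda>b c. c = ins x b)" by (intro dfn)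
    fix b assume b: "b \<epsilon> ?c"
    have m: "y \<epsilon> sep b (\<lambda>y. y \<noteq> x) \<longleftrightarrow> y \<epsilon> b \<and> y \<noteq> x" for y by (rule mem_sep) (intro dfn)
    have "b = ins x (sep b (\<lambda>y. y \<noteq> x))" using b m mem by (intro extensionality) auto
    moreover have "sep b (\<lambda>y. y \<noteq> x) \<epsilon> pow a" using b m mem by (auto simp: subset_def)
    ultimately show "\<exists>d. d \<epsilon> pow a \<and> b = ins x d" by blast
  qed simp
  moreover have "subset b (ins x a) \<Longrightarrow> \<not> x \<epsilon> b \<Longrightarrow> subset b a" for b
    by (auto simp: subset_def)
  ultimately show "Fin (pow (ins x a))"
    using mem by (rule_tac Fin_subset[OF Fin_un[OF \<open>Fin (pow a)\<close>, of ?c]]) auto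
qed

lemma Fin_prod: "Fin a \<Longrightarrow> Fin b \<Longrightarrow> Fin (prod a b)"
proof -
  assume "Fin a" and b: "Fin b"
  from \<open>Fin a\<close> show "Fin (prod a b)"
  proof (rule Fin_induct[where P = "\<lambda>a. Fin (prod a b)"])
    show "dfn1 (\<lambda>a. Fin (prod a b))" by (intro dfn)
    have "prod emp b = emp" by (rule extensionality) (simp add: mem_prod)
    then show "Fin (prod emp b)" by simp
    fix a x assume a: "Fin (prod a b)"
    have "Fin (prod (ins x emp) b)"
      by (rule Fin_image[of b "\<lambda>y p. p = pair x y", OF b]) (auto intro!: dfn simp: mem_prod)
    from Fin_un[OF a this] show "Fin (prod (ins x a) b)"
      by (rule Fin_subset) (auto simp: mem_prod)
  qed
qed

lemma Fin_nat: "n \<epsilon> om \<Longrightarrow> Fin n"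
  by (erule om_induct) (auto intro!: dfn Fin_ins simp: suc_def)

end

section \<open>The two principles in the model\<close>

context zf
begin

section \<open>Graphs, paths and the two principles as statements about the model\<close>

definition joined :: "'a \<Rightarrow> 'a \<Rightarrow> 'a \<Rightarrow> bool" where
  "joined Ed u v \<longleftrightarrow> upair u v \<epsilon> Ed"

definition graph :: "'a \<Rightarrow> 'a \<Rightarrow> bool" where
  "graph V Ed \<longleftrightarrow>
     (\<forall>e. e \<epsilon> Ed \<longrightarrow> (\<exists>u v. u \<epsilon> V \<and> v \<epsilon> V \<and> u \<noteq> v \<and> e = upair u v))"

definition locally_finite :: "'a \<Rightarrow> 'a \<Rightarrow> bool" where
  "locally_finite V Ed \<longleftrightarrow> (\<forall>v. v \<epsilon> V \<longrightarrow> Fin (sep Ed (\<lambda>e. v \<epsilon> e)))"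

definition path :: "'a \<Rightarrow> 'a \<Rightarrow> 'a \<Rightarrow> 'a \<Rightarrow> 'a \<Rightarrow> 'a \<Rightarrow> bool" where
  "path V Ed n p u v \<longleftrightarrow>
     isfun p (suc n) V \<and> injective p \<and> pair emp u \<epsilon> p \<and> pair n v \<epsilon> p \<and>
     (\<forall>i x y. i \<epsilon> n \<and> pair i x \<epsilon> p \<and> pair (suc i) y \<epsilon> p \<longrightarrow> joined Ed x y)"

definition reach :: "'a \<Rightarrow> 'a \<Rightarrow> 'a \<Rightarrow> 'a \<Rightarrow> 'a \<Rightarrow> bool" where
  "reach V Ed u v n \<longleftrightarrow> n \<epsilon> om \<and> (\<exists>p. path V Ed n p u v)"

definition connected :: "'a \<Rightarrow> 'a \<Rightarrow> bool" where
  "connected V Ed \<longleftrightarrow> (\<forall>u v. u \<epsilon> V \<and> v \<epsilon> V \<longrightarrow> (\<exists>n. reach V Ed u v n))"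

definition independent :: "'a \<Rightarrow> 'a \<Rightarrow> 'a \<Rightarrow> bool" where
  "independent V Ed I \<longleftrightarrow> subset I V \<and> (\<forall>u v. u \<epsilon> I \<and> v \<epsilon> I \<longrightarrow> \<not> joined Ed u v)"

definition maximal_independent :: "'a \<Rightarrow> 'a \<Rightarrow> 'a \<Rightarrow> bool" where
  "maximal_independent V Ed I \<longleftrightarrow>
     independent V Ed I \<and> \<not> (\<exists>J. independent V Ed J \<and> subset I J \<and> I \<noteq> J)"

definition choice_function :: "'a \<Rightarrow> 'a \<Rightarrow> bool" where
  "choice_function f a \<longleftrightarrow> (\<exists>b. isfun f a b) \<and> (\<forall>x y. pair x y \<epsilon> f \<longrightarrow> y \<epsilon> x)"

definition choice_fin_omega :: bool where
  "choice_fin_omega \<longleftrightarrow>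
     (\<forall>a. eqp a om \<and> (\<forall>x. x \<epsilon> a \<longrightarrow> (\<exists>y. y \<epsilon> x) \<and> Fin x) \<longrightarrow> (\<exists>f. choice_function f a))"

definition maximal_independent_lf_c :: bool where
  "maximal_independent_lf_c \<longleftrightarrow>
     (\<forall>V Ed. graph V Ed \<and> locally_finite V Ed \<and> connected V Ed \<longrightarrow>
       (\<exists>I. maximal_independent V Ed I))"

section \<open>Meaning of the formalized notions in the model\<close>

abbreviation H :: "nat \<Rightarrow> (nat \<Rightarrow> 'a) \<Rightarrow> lform \<Rightarrow> bool" where
  "H \<equiv> holds (=) E e0"

lemma holds_subset: "x < d \<Longrightarrow> y < d \<Longrightarrow> H d v (x \<^bold>\<subseteq> y) = subset (v x) (v y)"
  by (simp add: l_subset_def subset_def holds_simps)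

lemma holds_empty: "x < d \<Longrightarrow> H d v (l_empty x) = (v x = emp)"
  by (simp add: l_empty_def holds_simps empty_iff)

lemma upair_iff: "(\<forall>z. z \<epsilon> a \<longleftrightarrow> z = x \<or> z = y) \<longleftrightarrow> a = upair x y"
  using extensionality[of a "upair x y"] by auto

lemma holds_upair:
  "a < d \<Longrightarrow> x < d \<Longrightarrow> y < d \<Longrightarrow> H d v (l_upair a x y) = (v a = upair (v x) (v y))"
  by (simp add: l_upair_def holds_simps upair_iff)

lemma holds_opair:
  "p < d \<Longrightarrow> x < d \<Longrightarrow> y < d \<Longrightarrow> H d v (l_opair p x y) = (v p = pair (v x) (v y))"
  by (simp add: l_opair_def holds_simps holds_upair pair_def)

lemma holds_succ: "y < d \<Longrightarrow> x < d \<Longrightarrow> H d v (l_succ y x) = (v y = suc (v x))"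
  by (simp add: l_succ_def holds_simps suc_iff)

lemma holds_inductive: "a < d \<Longrightarrow> H d v (l_inductive a) = ind (v a)"
  by (auto simp: l_inductive_def holds_simps holds_empty holds_succ ind_def)

lemma om_iff: "ind w \<and> (\<forall>a. ind a \<longrightarrow> subset w a) \<longleftrightarrow> w = om"
proof
  have om: "ind om" by (simp add: ind_def suc_om)
  show "w = om" if w: "ind w \<and> (\<forall>a. ind a \<longrightarrow> subset w a)"
  proof (rule extensionality)
    show "z \<epsilon> w \<longleftrightarrow> z \<epsilon> om" for z
      using w om mem_om by (auto simp: subset_def)
  qed
  show "ind w \<and> (\<forall>a. ind a \<longrightarrow> subset w a)" if "w = om"
    using that om by (auto simp: subset_def mem_om)
qed

lemma holds_omega: "w < d \<Longrightarrow> H d v (l_omega w) = (v w = om)"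
  by (simp add: l_omega_def holds_simps holds_inductive holds_subset om_iff)

lemma holds_nat: "n < d \<Longrightarrow> H d v (l_nat n) = (v n \<epsilon> om)"
  by (simp add: l_nat_def holds_simps holds_omega)

lemma holds_maps:
  "f < d \<Longrightarrow> x < d \<Longrightarrow> y < d \<Longrightarrow> H d v (l_maps f x y) = (pair (v x) (v y) \<epsilon> v f)"
  by (simp add: l_maps_def holds_simps holds_opair)

lemma holds_fun:
  "f < d \<Longrightarrow> a < d \<Longrightarrow> b < d \<Longrightarrow> H d v (l_fun f a b) = isfun (v f) (v a) (v b)"
  by (simp add: l_fun_def holds_simps holds_opair holds_maps isfun_def)

lemma holds_inj: "f < d \<Longrightarrow> H d v (l_inj f) = injective (v f)"
  by (simp add: l_inj_def holds_simps holds_maps injective_def)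

lemma holds_onto: "f < d \<Longrightarrow> b < d \<Longrightarrow> H d v (l_onto f b) = onto (v f) (v b)"
  by (simp add: l_onto_def holds_simps holds_maps onto_def)

lemma holds_equipollent: "a < d \<Longrightarrow> b < d \<Longrightarrow> H d v (l_equipollent a b) = eqp (v a) (v b)"
  by (simp add: l_equipollent_def holds_simps holds_fun holds_inj holds_onto eqp_def)

lemma holds_finite: "a < d \<Longrightarrow> H d v (l_finite a) = Fin (v a)"
  by (simp add: l_finite_def holds_simps holds_nat holds_equipollent Fin_def)

lemma holds_denumerable: "a < d \<Longrightarrow> H d v (l_denumerable a) = eqp (v a) om"
  by (simp add: l_denumerable_def holds_simps holds_omega holds_equipollent)

lemma holds_choice_function:
  "f < d \<Longrightarrow> a < d \<Longrightarrow> H d v (l_choice_function f a) = choice_function (v f) (v a)"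
  by (simp add: l_choice_function_def holds_simps holds_fun holds_maps choice_function_def)

lemma holds_AC_fin_omega: "H 0 v AC_fin_omega = choice_fin_omega"
  by (simp add: AC_fin_omega_def holds_simps holds_denumerable holds_finite holds_choice_function
      choice_fin_omega_def)

lemma holds_graph: "V < d \<Longrightarrow> Ed < d \<Longrightarrow> H d v (l_graph V Ed) = graph (v V) (v Ed)"
  by (simp add: l_graph_def holds_simps holds_upair graph_def)

lemma holds_joined:
  "Ed < d \<Longrightarrow> x < d \<Longrightarrow> y < d \<Longrightarrow> H d v (l_joined Ed x y) = joined (v Ed) (v x) (v y)"
  by (simp add: l_joined_def holds_simps holds_upair joined_def)

lemma mem_incident: "e \<epsilon> sep Ed (\<lambda>e. v \<epsilon> e) \<longleftrightarrow> e \<epsilon> Ed \<and> v \<epsilon> e"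
  by (rule mem_sep) (intro dfn)

lemma incident_iff: "(\<forall>e. e \<epsilon> D \<longleftrightarrow> e \<epsilon> Ed \<and> v \<epsilon> e) \<longleftrightarrow> D = sep Ed (\<lambda>e. v \<epsilon> e)"
  using extensionality[of D "sep Ed (\<lambda>e. v \<epsilon> e)"] mem_incident by auto

lemma holds_locally_finite:
  "V < d \<Longrightarrow> Ed < d \<Longrightarrow> H d v (l_locally_finite V Ed) = locally_finite (v V) (v Ed)"
  by (simp add: l_locally_finite_def holds_simps holds_finite incident_iff locally_finite_def)

lemma holds_path:
  "V < d \<Longrightarrow> Ed < d \<Longrightarrow> n < d \<Longrightarrow> p < d \<Longrightarrow> x < d \<Longrightarrow> y < d \<Longrightarrow>
    H d v (l_path V Ed n p x y) = path (v V) (v Ed) (v n) (v p) (v x) (v y)"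
  by (simp add: l_path_def holds_simps holds_succ holds_fun holds_inj holds_empty holds_maps
      holds_joined path_def)

lemma holds_connected:
  "V < d \<Longrightarrow> Ed < d \<Longrightarrow> H d v (l_connected V Ed) = connected (v V) (v Ed)"
  by (simp add: l_connected_def holds_simps holds_nat holds_path connected_def reach_def)

lemma holds_independent:
  "V < d \<Longrightarrow> Ed < d \<Longrightarrow> I < d \<Longrightarrow>
    H d v (l_independent V Ed I) = independent (v V) (v Ed) (v I)"
  by (simp add: l_independent_def holds_simps holds_subset holds_joined independent_def)

lemma holds_maximal_independent:
  "V < d \<Longrightarrow> Ed < d \<Longrightarrow> I < d \<Longrightarrow>
    H d v (l_maximal_independent V Ed I) = maximal_independent (v V) (v Ed) (v I)"
  by (simp add: l_maximal_independent_def holds_simps holds_subset holds_independent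
      maximal_independent_def)

lemma holds_P_lf_c: "H 0 v P_lf_c = maximal_independent_lf_c"
  by (simp add: P_lf_c_def holds_simps holds_graph holds_locally_finite holds_connected
      holds_maximal_independent maximal_independent_lf_c_def)

lemma dfn_joined [dfn]:
  "dterm f \<Longrightarrow> dterm g \<Longrightarrow> dterm h \<Longrightarrow> definable (\<lambda>v. joined (f v) (g v) (h v))"
  unfolding joined_def by (intro dfn)

lemma dfn_reach [dfn]:
  assumes "dterm g" "dterm h"
  shows "definable (\<lambda>v. reach V Ed u (g v) (h v))"
proof (rule dfn_subst2[OF _ assms])
  show "dfn2 (reach V Ed u)" unfolding reach_def path_def by (intro dfn)
qed

lemma joined_sym: "joined Ed u v \<longleftrightarrow> joined Ed v u"
proof -
  have "upair u v = upair v u" by (rule extensionality) auto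
  then show ?thesis by (simp add: joined_def)
qed

lemma upair_eq_iff: "upair a b = upair c d \<longleftrightarrow> a = c \<and> b = d \<or> a = d \<and> b = c"
proof
  assume "upair a b = upair c d"
  then have "z = a \<or> z = b \<longleftrightarrow> z = c \<or> z = d" for z by (metis mem_upair)
  then show "a = c \<and> b = d \<or> a = d \<and> b = c" by metis
qed (auto intro: extensionality)

lemma graph_joinedD:
  assumes "graph V Ed" "joined Ed u v"
  shows "u \<epsilon> V" "v \<epsilon> V" "u \<noteq> v"
  using assms unfolding graph_def joined_def by (metis upair_eq_iff)+

subsection \<open>Greedy maximal independent sets\<close>

text \<open>
  The greedy set \<open>I\<close> consists of the \<open>v\<close> without a smaller neighbour in \<open>I\<close>. This recursion is solved
  by approximations: sets satisfying it on an initial segment, any two of which agree.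
\<close>

lemma greedy_maximal_independent:
  assumes "graph V Ed" and L: "dfn2 L"
    and irrefl: "\<And>x. \<not> L x x"
    and trans: "\<And>x y z. L x y \<Longrightarrow> L y z \<Longrightarrow> L x z"
    and total: "\<And>x y. x \<epsilon> V \<Longrightarrow> y \<epsilon> V \<Longrightarrow> x \<noteq> y \<Longrightarrow> L x y \<or> L y x"
    and least: "\<And>P x. dfn1 P \<Longrightarrow> x \<epsilon> V \<Longrightarrow> P x \<Longrightarrow>
      \<exists>m. m \<epsilon> V \<and> P m \<and> (\<forall>k. k \<epsilon> V \<longrightarrow> L k m \<longrightarrow> \<not> P k)"
  shows "\<exists>I. maximal_independent V Ed I"
proof -
  note dfn_L = dfn_subst2[OF L]
  define approx where "approx v J \<longleftrightarrow>
    (\<forall>u. u \<epsilon> J \<longrightarrow> u \<epsilon> V) \<and>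
    (\<forall>u. u \<epsilon> V \<and> (u = v \<or> L u v) \<longrightarrow> (u \<epsilon> J \<longleftrightarrow> \<not> (\<exists>w. w \<epsilon> J \<and> L w u \<and> joined Ed w u)))"
    for v J
  have dfn_approx: "dfn2 approx" unfolding approx_def by (intro dfn dfn_L)
  \<comment> \<open>At a least vertex of disagreement the two sets agree on all smaller ones, so the
    recursion decides that vertex alike.\<close>
  have agree: "u \<epsilon> J \<longleftrightarrow> u \<epsilon> J'"
    if J: "approx v J" and J': "approx v J'" and u: "u \<epsilon> V" "u = v \<or> L u v" for u v J J'
  proof (rule ccontr)
    assume "\<not> (u \<epsilon> J \<longleftrightarrow> u \<epsilon> J')"
    moreover define P where "P u \<longleftrightarrow> (u = v \<or> L u v) \<and> \<not> (u \<epsilon> J \<longleftrightarrow> u \<epsilon> J')" for u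
    moreover have "dfn1 P" unfolding P_def by (intro dfn dfn_L)
    ultimately obtain m where "m \<epsilon> V" "P m" and *: "\<forall>k. k \<epsilon> V \<longrightarrow> L k m \<longrightarrow> \<not> P k"
      using least[of P u] u by blast
    then have m: "m \<epsilon> V" "m = v \<or> L m v" "\<not> (m \<epsilon> J \<longleftrightarrow> m \<epsilon> J')" by (auto simp: P_def)
    have same: "w \<epsilon> J \<longleftrightarrow> w \<epsilon> J'" if "L w m" for w
    proof (cases "w \<epsilon> V")
      case True
      have "L w v" using m(2) that trans by blast
      then show ?thesis using True * that unfolding P_def by blast
    next
      case False
      then show ?thesis using J J' unfolding approx_def by blast
    qed
    have "m \<epsilon> K \<longleftrightarrow> \<not> (\<exists>w. w \<epsilon> K \<and> L w m \<and> joined Ed w m)" if "approx v K" for K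
      using that m(1,2) unfolding approx_def by blast
    from this[OF J] this[OF J'] show False using m(3) same by blast
  qed
  define I where "I = sep V (\<lambda>x. \<exists>J. approx x J \<and> x \<epsilon> J)"
  have I: "x \<epsilon> I \<longleftrightarrow> x \<epsilon> V \<and> (\<exists>J. approx x J \<and> x \<epsilon> J)" for x
    unfolding I_def by (rule mem_sep) (intro dfn dfn_subst2[OF dfn_approx])
  have key: "v \<epsilon> I \<longleftrightarrow> \<not> (\<exists>w. w \<epsilon> I \<and> L w v \<and> joined Ed w v)" if x: "v \<epsilon> V" for v
  proof (rule ccontr)
    assume "\<not> ?thesis"
    moreover define P where
      "P v \<longleftrightarrow> \<not> (v \<epsilon> I \<longleftrightarrow> \<not> (\<exists>w. w \<epsilon> I \<and> L w v \<and> joined Ed w v))" for v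
    moreover have "dfn1 P" unfolding P_def by (intro dfn dfn_L)
    ultimately obtain v where v: "v \<epsilon> V" "P v" and IH: "\<forall>u. u \<epsilon> V \<longrightarrow> L u v \<longrightarrow> \<not> P u"
      using least[of P v] x by blast
    note v = v[unfolded P_def] and IH = IH[unfolded P_def not_not, rule_format]
    \<comment> \<open>\<open>J\<close> is \<open>I\<close> below \<open>v\<close>, with
      \<open>v\<close> decided by the recursion. It is an approximation at \<open>v\<close>, so
      \<open>I\<close> agrees with it there and \<open>v\<close> cannot be a failure.\<close>
    define J where "J = sep V (\<lambda>u. (u \<epsilon> I \<and> L u v) \<or>
      (u = v \<and> \<not> (\<exists>w. w \<epsilon> I \<and> L w v \<and> joined Ed w v)))"
    have J: "u \<epsilon> J \<longleftrightarrow> u \<epsilon> V \<and> ((u \<epsilon> I \<and> L u v) \<or>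
      (u = v \<and> \<not> (\<exists>w. w \<epsilon> I \<and> L w v \<and> joined Ed w v)))" for u
      unfolding J_def by (rule mem_sep) (intro dfn dfn_L)
    have below: "u \<epsilon> J \<longleftrightarrow> u \<epsilon> I" if "L u v" for u using that J I irrefl by blast
    have "approx v J"
      unfolding approx_def
    proof (intro conjI allI impI)
      fix u assume u: "u \<epsilon> V \<and> (u = v \<or> L u v)"
      have "(\<exists>w. w \<epsilon> J \<and> L w u \<and> joined Ed w u) \<longleftrightarrow> (\<exists>w. w \<epsilon> I \<and> L w u \<and> joined Ed w u)"
        using u below trans by blast
      then show "u \<epsilon> J \<longleftrightarrow> \<not> (\<exists>w. w \<epsilon> J \<and> L w u \<and> joined Ed w u)"
        using u IH[of u] below J irrefl by metis
    qed (use J in blast)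
    then have "v \<epsilon> I \<longleftrightarrow> v \<epsilon> J" using agree[of v J _ v] I v(1) by blast
    then show False using v J irrefl by blast
  qed
  have "independent V Ed I"
    unfolding independent_def
  proof (intro conjI allI impI notI)
    show "subset I V" using I by (simp add: subset_def)
    fix u v assume "u \<epsilon> I \<and> v \<epsilon> I" and "joined Ed u v"
    then have "L u v \<or> L v u" using graph_joinedD[OF assms(1)] total I by blast
    then show False
      using key[of u] key[of v] \<open>u \<epsilon> I \<and> v \<epsilon> I\<close> \<open>joined Ed u v\<close> joined_sym I by blast
  qed
  moreover have "I = J" if J: "independent V Ed J" "subset I J" for J
  proof (rule extensionality)
    \<comment> \<open>A vertex of \<open>J\<close> outside \<open>I\<close> has by
      \<open>key\<close> a neighbour in \<open>I\<close> and hence in \<open>J\<close>, against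
      independence.\<close>
    show "z \<epsilon> I \<longleftrightarrow> z \<epsilon> J" for z
      using J key[of z] unfolding independent_def subset_def by blast
  qed
  ultimately show ?thesis unfolding maximal_independent_def by blast
qed

subsection \<open>Orders of finite sets\<close>

text \<open>\<open>R\<close> is the order of \<open>s\<close> pulled back from some injection of \<open>s\<close> into a natural number.\<close>

definition nat_order :: "'a \<Rightarrow> 'a \<Rightarrow> bool" where
  "nat_order s R \<longleftrightarrow> R \<epsilon> pow (prod s s) \<and>
     (\<exists>f n. n \<epsilon> om \<and> isfun f s n \<and> injective f \<and>
       (\<forall>x y. pair x y \<epsilon> R \<longleftrightarrow> x \<epsilon> s \<and> y \<epsilon> s \<and>
         (\<exists>i j. pair x i \<epsilon> f \<and> pair y j \<epsilon> f \<and> i \<epsilon> j)))"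

lemma dfn_nat_order [dfn]:
  "dterm f \<Longrightarrow> dterm g \<Longrightarrow> definable (\<lambda>v. nat_order (f v) (g v))"
  by (rule dfn_subst2[of nat_order]; (assumption | (unfold nat_order_def, intro dfn)))

lemma nat_order_ex:
  assumes "Fin s" shows "\<exists>R. nat_order s R"
proof -
  obtain n f where f: "n \<epsilon> om" "isfun f s n" "injective f"
    using assms unfolding Fin_def eqp_def by blast
  let ?R = "sep (prod s s) (\<lambda>p. \<exists>x y i j. p = pair x y \<and> pair x i \<epsilon> f \<and> pair y j \<epsilon> f \<and> i \<epsilon> j)"
  have R: "p \<epsilon> ?R \<longleftrightarrow> p \<epsilon> prod s s \<and>
      (\<exists>x y i j. p = pair x y \<and> pair x i \<epsilon> f \<and> pair y j \<epsilon> f \<and> i \<epsilon> j)" for p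
    by (rule mem_sep) (intro dfn)
  have "?R \<epsilon> pow (prod s s)" using R by (simp add: subset_def)
  moreover have "pair x y \<epsilon> ?R \<longleftrightarrow> x \<epsilon> s \<and> y \<epsilon> s \<and>
      (\<exists>i j. pair x i \<epsilon> f \<and> pair y j \<epsilon> f \<and> i \<epsilon> j)" for x y
    unfolding R by auto
  ultimately show ?thesis unfolding nat_order_def using f by blast
qed

lemma nat_order_irrefl:
  assumes "nat_order s R" shows "\<not> pair x x \<epsilon> R"
  using assms isfun_unique not_mem_self unfolding nat_order_def by metis

lemma nat_order_trans:
  assumes "nat_order s R" "pair x y \<epsilon> R" "pair y z \<epsilon> R"
  shows "pair x z \<epsilon> R"
proof -
  obtain f n where f: "n \<epsilon> om" "isfun f s n"
    and R: "\<And>x y. pair x y \<epsilon> R \<longleftrightarrow> x \<epsilon> s \<and> y \<epsilon> s \<and>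
         (\<exists>i j. pair x i \<epsilon> f \<and> pair y j \<epsilon> f \<and> i \<epsilon> j)"
    using assms(1) unfolding nat_order_def by auto
  obtain i j where ij: "x \<epsilon> s" "pair x i \<epsilon> f" "pair y j \<epsilon> f" "i \<epsilon> j"
    using assms(2) R by blast
  obtain j' k where jk: "z \<epsilon> s" "pair y j' \<epsilon> f" "pair z k \<epsilon> f" "j' \<epsilon> k"
    using assms(3) R by blast
  have "j' = j" using ij jk isfun_unique[OF f(2)] by blast
  moreover have "k \<epsilon> om" using isfun_memD[OF f(2) jk(3)] om_trans f(1) by blast
  ultimately have "i \<epsilon> k" using ij jk nat_trans by blast
  then show ?thesis using R ij jk by blast
qed

lemma nat_order_total:
  assumes "nat_order s R" "x \<epsilon> s" "y \<epsilon> s" "x \<noteq> y"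
  shows "pair x y \<epsilon> R \<or> pair y x \<epsilon> R"
proof -
  obtain f n where f: "n \<epsilon> om" "isfun f s n" "injective f"
    and R: "\<And>x y. pair x y \<epsilon> R \<longleftrightarrow> x \<epsilon> s \<and> y \<epsilon> s \<and>
         (\<exists>i j. pair x i \<epsilon> f \<and> pair y j \<epsilon> f \<and> i \<epsilon> j)"
    using assms(1) unfolding nat_order_def by auto
  obtain i j where ij: "pair x i \<epsilon> f" "pair y j \<epsilon> f"
    using isfun_ex[OF f(2)] assms(2,3) by blast
  then have "i \<epsilon> om" "j \<epsilon> om" using isfun_memD[OF f(2)] om_trans f(1) by blast+
  moreover have "i \<noteq> j" using ij injectiveD[OF f(3)] assms(4) by blast
  ultimately have "i \<epsilon> j \<or> j \<epsilon> i" using nat_linear by blast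
  then show ?thesis using R ij assms(2,3) by blast
qed

lemma nat_order_least:
  assumes "nat_order s R" "dfn1 P" "x \<epsilon> s" "P x"
  shows "\<exists>m. m \<epsilon> s \<and> P m \<and> (\<forall>k. pair k m \<epsilon> R \<longrightarrow> \<not> P k)"
proof -
  obtain f n where f: "n \<epsilon> om" "isfun f s n"
    and R: "\<And>x y. pair x y \<epsilon> R \<longleftrightarrow> x \<epsilon> s \<and> y \<epsilon> s \<and>
         (\<exists>i j. pair x i \<epsilon> f \<and> pair y j \<epsilon> f \<and> i \<epsilon> j)"
    using assms(1) unfolding nat_order_def by auto
  \<comment> \<open>The least number of an element satisfying \<open>P\<close> exists in
    \<open>om\<close>; its preimage under \<open>f\<close> is least for \<open>R\<close>.\<close>
  let ?Q = "\<lambda>i. \<exists>y. pair y i \<epsilon> f \<and> P y"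
  obtain i where "pair x i \<epsilon> f" using isfun_ex[OF f(2) assms(3)] by blast
  then have "?Q i" "i \<epsilon> n" using assms(4) isfun_memD[OF f(2)] by blast+
  moreover have "dfn1 ?Q" by (intro dfn dfn_subst1[OF assms(2)])
  ultimately obtain j where j: "?Q j" "\<forall>k. k \<epsilon> j \<longrightarrow> \<not> ?Q k"
    using nat_least[of ?Q i] om_trans f(1) by blast
  then obtain m where "pair m j \<epsilon> f" "P m" by blast
  moreover have "\<not> P k" if km: "pair k m \<epsilon> R" for k
  proof -
    obtain a b where "pair k a \<epsilon> f" "pair m b \<epsilon> f" "a \<epsilon> b" using R km by blast
    moreover have "b = j" using calculation \<open>pair m j \<epsilon> f\<close> isfun_unique[OF f(2)] by blast
    ultimately show ?thesis using j by blast
  qed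
  ultimately show ?thesis using isfun_memD[OF f(2)] by blast
qed

end

section \<open>From choice to maximal independent sets\<close>

context zf
begin

text \<open>The restriction of \<open>p\<close> to \<open>suc i\<close> is the path. It serves both
  to shorten a path by one edge and to cut a path at a vertex that it visits.\<close>

lemma path_prefix:
  assumes path: "path V Ed n p u v" and n: "n \<epsilon> om" and w: "pair i w \<epsilon> p"
  shows "reach V Ed u w i"
proof -
  have p: "isfun p (suc n) V" "injective p" "pair emp u \<epsilon> p"
    and edge: "\<And>i x y. i \<epsilon> n \<Longrightarrow> pair i x \<epsilon> p \<Longrightarrow> pair (suc i) y \<epsilon> p \<Longrightarrow> joined Ed x y"
    using path unfolding path_def by auto
  have i: "i \<epsilon> suc n" using isfun_memD[OF p(1) w] by blast
  have "i \<epsilon> om" using i n om_trans suc_om by blast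
  have sub: "k \<epsilon> suc n" if "k \<epsilon> suc i" for k
    using that i nat_trans[of k i "suc n"] suc_om[OF n] by (metis mem_suc)
  have sub': "k \<epsilon> n" if "k \<epsilon> i" for k
    using that i nat_trans[of k i n] n by (metis mem_suc)
  let ?q = "sep p (\<lambda>z. \<exists>k x. k \<epsilon> suc i \<and> z = pair k x)"
  have mem: "z \<epsilon> ?q \<longleftrightarrow> z \<epsilon> p \<and> (\<exists>k x. k \<epsilon> suc i \<and> z = pair k x)" for z
    by (rule mem_sep) (intro dfn)
  then have pair: "pair k x \<epsilon> ?q \<longleftrightarrow> pair k x \<epsilon> p \<and> k \<epsilon> suc i" for k x by auto
  have "isfun ?q (suc i) V"
    unfolding isfun_def
  proof (intro conjI allI impI)
    show "\<exists>x y. x \<epsilon> suc i \<and> y \<epsilon> V \<and> z = pair x y" if "z \<epsilon> ?q" for z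
      using that isfun_memD[OF p(1)] unfolding mem by blast
    show "\<exists>y. pair x y \<epsilon> ?q \<and> (\<forall>z. pair x z \<epsilon> ?q \<longrightarrow> z = y)" if "x \<epsilon> suc i" for x
      using isfun_ex[OF p(1) sub[OF that]] isfun_unique[OF p(1)] that unfolding pair by blast
  qed
  moreover have "injective ?q" using p(2) unfolding injective_def pair by blast
  moreover have "pair emp u \<epsilon> ?q" using p(3) emp_mem_suc \<open>i \<epsilon> om\<close> unfolding pair by blast
  moreover have "pair i w \<epsilon> ?q" using w unfolding pair by simp
  ultimately have "path V Ed i ?q u w"
    unfolding path_def using edge sub' pair by blast
  then show ?thesis using \<open>i \<epsilon> om\<close> unfolding reach_def by blast
qed

lemma reach_suc:
  assumes "reach V Ed u v (suc n)" "n \<epsilon> om"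
  shows "\<exists>w. reach V Ed u w n \<and> joined Ed w v"
proof -
  obtain p where p: "path V Ed (suc n) p u v" using assms(1) unfolding reach_def by blast
  then have "isfun p (suc (suc n)) V" unfolding path_def by blast
  then obtain w where w: "pair n w \<epsilon> p" using isfun_ex[of p "suc (suc n)" V n] by auto
  have "pair (suc n) v \<epsilon> p" using p unfolding path_def by blast
  then have "joined Ed w v" using p w unfolding path_def by (metis mem_suc)
  then show ?thesis using path_prefix[OF p suc_om[OF assms(2)] w] by blast
qed

lemma reach_emp: "reach V Ed u v emp \<Longrightarrow> v = u"
  unfolding reach_def path_def using isfun_unique by blast

lemma reach_vertex: "reach V Ed u v n \<Longrightarrow> v \<epsilon> V"
  unfolding reach_def path_def using isfun_memD by blast

end

section \<open>Spheres around a root, their orders, and the order of the vertices\<close>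

locale rooted_graph = zf E e0 for E :: "'a \<Rightarrow> 'a \<Rightarrow> bool" (infix "\<epsilon>" 50) and e0 +
  fixes V Ed r :: 'a
  assumes graph: "graph V Ed" and lf: "locally_finite V Ed" and conn: "connected V Ed"
    and root: "r \<epsilon> V"
begin

text \<open>Paths need not be shortest, so spheres may overlap and \<open>sphere n\<close> may
  contain vertices nearer to the root than \<open>n\<close>.\<close>

definition sphere :: "'a \<Rightarrow> 'a" where
  "sphere n = sep V (\<lambda>v. reach V Ed r v n)"

lemma dt_sphere [dfn]: "dterm f \<Longrightarrow> dterm (\<lambda>v. sphere (f v))"
proof (rule dt_subst1[of sphere])
  show "definable (\<lambda>v. v 0 = sphere (v (Suc 0)))" unfolding sphere_def by (intro dfn)
qed

lemma mem_sphere: "v \<epsilon> sphere n \<longleftrightarrow> reach V Ed r v n"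
  unfolding sphere_def by (subst mem_sep) (auto intro!: dfn reach_vertex)

text \<open>A vertex of \<open>sphere (suc n)\<close> lies on an edge incident with a vertex of
  \<open>sphere n\<close>. These edges form a finite union of finite sets, and each edge has two
  elements.\<close>

lemma Fin_sphere: "n \<epsilon> om \<Longrightarrow> Fin (sphere n)"
proof (erule om_induct)
  show "dfn1 (\<lambda>n. Fin (sphere n))" by (intro dfn)
  show "Fin (sphere emp)"
    by (rule Fin_subset[OF Fin_ins[OF Fin_emp, of r]]) (auto simp: mem_sphere dest: reach_emp)
next
  fix n assume n: "n \<epsilon> om" and fin: "Fin (sphere n)"
  let ?inc = "\<lambda>v. sep Ed (\<lambda>e. v \<epsilon> e)"
  let ?C = "sep (pow Ed) (\<lambda>D. \<exists>w. w \<epsilon> sphere n \<and> D = ?inc w)"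
  have C: "D \<epsilon> ?C \<longleftrightarrow> D \<epsilon> pow Ed \<and> (\<exists>w. w \<epsilon> sphere n \<and> D = ?inc w)" for D
    by (rule mem_sep) (intro dfn)
  have "Fin ?C"
    by (rule Fin_image[of "sphere n" "\<lambda>w D. D = ?inc w", OF fin])
      (use C in \<open>auto intro!: dfn\<close>)
  moreover have "Fin D" if D: "D \<epsilon> ?C" for D
  proof -
    obtain w where "w \<epsilon> sphere n" "D = ?inc w" using D unfolding C by blast
    moreover have "w \<epsilon> V" using calculation(1) reach_vertex unfolding mem_sphere by blast
    ultimately show ?thesis using lf unfolding locally_finite_def by simp
  qed
  ultimately have "Fin (union ?C)" by (rule Fin_union)
  moreover have "Fin e" if "e \<epsilon> union ?C" for e
  proof -
    obtain w where "e \<epsilon> ?inc w" using \<open>e \<epsilon> union ?C\<close> unfolding mem_union C by blast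
    then obtain x y where "e = upair x y" using graph unfolding graph_def mem_incident by blast
    then show ?thesis
      by (intro Fin_subset[OF Fin_ins[OF Fin_ins[OF Fin_emp, of x], of y]]) auto
  qed
  ultimately have "Fin (union (union ?C))" by (rule Fin_union)
  then show "Fin (sphere (suc n))"
  proof (rule Fin_subset)
    fix v assume "v \<epsilon> sphere (suc n)"
    then obtain w where w: "w \<epsilon> sphere n" "joined Ed w v"
      using reach_suc n unfolding mem_sphere by blast
    then have "upair w v \<epsilon> ?inc w" unfolding mem_incident joined_def by simp
    moreover have "?inc w \<epsilon> ?C" unfolding C using w by (auto simp: subset_def mem_incident)
    ultimately have "upair w v \<epsilon> union ?C" unfolding mem_union by blast
    then show "v \<epsilon> union (union ?C)" unfolding mem_union[of v] by (intro exI[of _ "upair w v"]) simp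
  qed
qed

text \<open>The tag \<open>n\<close> makes the orders of different spheres distinct, so that the family is denumerable.\<close>

definition orders :: "'a \<Rightarrow> 'a" where
  "orders n = sep (prod (upair n n) (pow (prod V V)))
     (\<lambda>q. \<exists>R. q = pair n R \<and> nat_order (sphere n) R)"

lemma dt_orders [dfn]: "dterm f \<Longrightarrow> dterm (\<lambda>v. orders (f v))"
proof (rule dt_subst1[of orders])
  show "definable (\<lambda>v. v 0 = orders (v (Suc 0)))" unfolding orders_def by (intro dfn)
qed

lemma mem_orders: "q \<epsilon> orders n \<longleftrightarrow> (\<exists>R. q = pair n R \<and> nat_order (sphere n) R)"
proof -
  have "R \<epsilon> pow (prod V V)" if "nat_order (sphere n) R" for R
  proof -
    have "subset R (prod (sphere n) (sphere n))" using that unfolding nat_order_def by simp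
    moreover have "subset (prod (sphere n) (sphere n)) (prod V V)"
      using reach_vertex by (auto simp: subset_def mem_prod mem_sphere)
    ultimately show ?thesis by (simp add: subset_def)
  qed
  moreover have "q \<epsilon> orders n \<longleftrightarrow> q \<epsilon> prod (upair n n) (pow (prod V V)) \<and>
      (\<exists>R. q = pair n R \<and> nat_order (sphere n) R)"
    unfolding orders_def by (rule mem_sep) (intro dfn)
  ultimately show ?thesis by auto
qed

lemma Fin_orders: "n \<epsilon> om \<Longrightarrow> Fin (orders n)"
proof (rule Fin_subset)
  assume n: "n \<epsilon> om"
  have "Fin (upair n n)"
    by (rule Fin_subset[OF Fin_ins[OF Fin_emp, of n]]) simp
  then show "Fin (prod (upair n n) (pow (prod (sphere n) (sphere n))))"
    using Fin_sphere[OF n] by (intro Fin_prod Fin_pow)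
  show "q \<epsilon> prod (upair n n) (pow (prod (sphere n) (sphere n)))" if "q \<epsilon> orders n" for q
    using that unfolding mem_orders nat_order_def by auto
qed

lemma orders_nonempty: "n \<epsilon> om \<Longrightarrow> \<exists>q. q \<epsilon> orders n"
  using nat_order_ex[OF Fin_sphere] mem_orders by blast

lemma orders_inject: "n \<epsilon> om \<Longrightarrow> orders n = orders m \<Longrightarrow> n = m"
  using orders_nonempty mem_orders by (metis pair_inject)

text \<open>A choice function maps the set \<open>orders n\<close> to one of its tagged orders; here
  the tag is stripped.\<close>

definition chosen :: "'a \<Rightarrow> 'a \<Rightarrow> 'a \<Rightarrow> bool" where
  "chosen c n R \<longleftrightarrow> pair (orders n) (pair n R) \<epsilon> c"

lemma sphere_orders:
  assumes choice_fin_omega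
  shows "\<exists>c. (\<forall>n R. chosen c n R \<longrightarrow> nat_order (sphere n) R) \<and>
    (\<forall>n. n \<epsilon> om \<longrightarrow> (\<exists>R. chosen c n R)) \<and>
    (\<forall>n R R'. chosen c n R \<longrightarrow> chosen c n R' \<longrightarrow> R = R')"
proof -
  \<comment> \<open>All the sets \<open>orders n\<close> lie in one power set, so separation
    collects them into a set.\<close>
  define A where "A = sep (pow (prod om (pow (prod V V)))) (\<lambda>x. \<exists>n. n \<epsilon> om \<and> x = orders n)"
  have "orders n \<epsilon> pow (prod om (pow (prod V V)))" if "n \<epsilon> om" for n
  proof -
    have "subset (orders n) (prod (upair n n) (pow (prod V V)))"
      unfolding orders_def subset_def by (subst mem_sep) (auto intro!: dfn)
    then show ?thesis using that by (auto simp: subset_def mem_prod)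
  qed
  moreover have "x \<epsilon> A \<longleftrightarrow>
      x \<epsilon> pow (prod om (pow (prod V V))) \<and> (\<exists>n. n \<epsilon> om \<and> x = orders n)" for x
    unfolding A_def by (rule mem_sep) (intro dfn)
  ultimately have A: "x \<epsilon> A \<longleftrightarrow> (\<exists>n. n \<epsilon> om \<and> x = orders n)" for x by blast
  have "eqp A om"
  proof (rule eqpI[of "\<lambda>x n. x = orders n"])
    show "dfn2 (\<lambda>x n. x = orders n)" by (intro dfn)
    show "m = n" if "m \<epsilon> om" "x = orders m" "x = orders n" for x m n
      using that orders_inject by blast
  qed (use A in blast)+
  moreover have "(\<exists>y. y \<epsilon> x) \<and> Fin x" if x: "x \<epsilon> A" for x
  proof -
    obtain n where n: "n \<epsilon> om" "x = orders n" using x A by blast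
    show ?thesis unfolding n(2) using Fin_orders[OF n(1)] orders_nonempty[OF n(1)] by blast
  qed
  ultimately obtain c where c: "choice_function c A"
    using assms unfolding choice_fin_omega_def by blast
  then obtain b where fn: "isfun c A b" unfolding choice_function_def by blast
  have mem: "y \<epsilon> x" if "pair x y \<epsilon> c" for x y using c that unfolding choice_function_def by blast
  have "nat_order (sphere n) R" if "chosen c n R" for n R
  proof -
    have "pair n R \<epsilon> orders n" using mem that unfolding chosen_def by blast
    then show ?thesis unfolding mem_orders by auto
  qed
  moreover have "\<exists>R. chosen c n R" if n: "n \<epsilon> om" for n
  proof -
    obtain y where y: "pair (orders n) y \<epsilon> c" using isfun_ex[OF fn] A n by blast
    then show ?thesis using mem[OF y] unfolding mem_orders chosen_def by blast
  qed
  moreover have "R = R'" if "chosen c n R" "chosen c n R'" for n R R'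
    using isfun_unique[OF fn] that unfolding chosen_def by (metis pair_inject)
  ultimately show ?thesis by blast
qed

text \<open>This is the distance from the root; it assigns to each vertex just one of the spheres
  containing it.\<close>

definition level :: "'a \<Rightarrow> 'a \<Rightarrow> bool" where
  "level v n \<longleftrightarrow> reach V Ed r v n \<and> (\<forall>k. k \<epsilon> n \<longrightarrow> \<not> reach V Ed r v k)"

lemma dfn_level [dfn]: "dterm f \<Longrightarrow> dterm g \<Longrightarrow> definable (\<lambda>v. level (f v) (g v))"
  by (rule dfn_subst2[of level]; (assumption | (unfold level_def, intro dfn)))

lemma level_nat: "level v n \<Longrightarrow> n \<epsilon> om"
  unfolding level_def reach_def by blast

lemma level_ex: "v \<epsilon> V \<Longrightarrow> \<exists>n. level v n"
proof -
  assume "v \<epsilon> V"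
  then obtain n where n: "reach V Ed r v n" using conn root unfolding connected_def by blast
  have "dfn1 (reach V Ed r v)" by (intro dfn)
  then show ?thesis
    using nat_least[of "reach V Ed r v" n] n unfolding level_def reach_def by blast
qed

lemma level_unique: "level v m \<Longrightarrow> level v n \<Longrightarrow> m = n"
  using nat_linear[OF level_nat level_nat, of v m v n] unfolding level_def by blast

text \<open>Vertices are ordered by level, and within a level by the chosen order of the sphere.\<close>

theorem maximal_independent_exists:
  assumes choice_fin_omega
  shows "\<exists>I. maximal_independent V Ed I"
proof -
  obtain c where c: "(\<forall>n R. chosen c n R \<longrightarrow> nat_order (sphere n) R) \<and>
    (\<forall>n. n \<epsilon> om \<longrightarrow> (\<exists>R. chosen c n R)) \<and>
    (\<forall>n R R'. chosen c n R \<longrightarrow> chosen c n R' \<longrightarrow> R = R')"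
    using sphere_orders[OF assms] by blast
  define ch where "ch = chosen c"
  \<comment> \<open>The choice function \<open>c\<close> is a set of the model and so a permitted
    parameter; this is what makes the order \<open>L\<close> definable.\<close>
  have dfn_ch: "dfn2 ch" unfolding ch_def chosen_def by (intro dfn)
  have ch_order: "nat_order (sphere n) R" if "ch n R" for n R
    using c that unfolding ch_def by blast
  have ch_ex: "\<exists>R. ch n R" if "n \<epsilon> om" for n using c that unfolding ch_def by blast
  have ch_unique: "R = R'" if "ch n R" "ch n R'" for n R R' using c that unfolding ch_def by blast
  define L where "L u v \<longleftrightarrow> (\<exists>m n. level u m \<and> level v n \<and>
      (m \<epsilon> n \<or> m = n \<and> (\<exists>R. ch m R \<and> pair u v \<epsilon> R)))" for u v
  show ?thesis
  proof (rule greedy_maximal_independent[OF graph])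
    show "dfn2 L" unfolding L_def by (intro dfn dfn_subst2[OF dfn_ch])
  next
    show "\<not> L x x" for x
      unfolding L_def using level_unique nat_order_irrefl ch_order not_mem_self by blast
  next
    fix x y z assume "L x y" "L y z"
    then obtain l m n where lev: "level x l" "level y m" "level z n"
      and 1: "l \<epsilon> m \<or> l = m \<and> (\<exists>R. ch l R \<and> pair x y \<epsilon> R)"
      and 2: "m \<epsilon> n \<or> m = n \<and> (\<exists>R. ch m R \<and> pair y z \<epsilon> R)"
      unfolding L_def using level_unique by metis
    show "L x z"
    proof (cases "l = m \<and> m = n")
      case True
      then obtain R R' where R: "ch l R" "pair x y \<epsilon> R" "ch l R'" "pair y z \<epsilon> R'"
        using 1 2 not_mem_self by metis
      then have "pair x z \<epsilon> R" using nat_order_trans ch_order ch_unique by blast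
      then show ?thesis unfolding L_def using lev True R(1) by blast
    next
      case False
      then have "l \<epsilon> n" using 1 2 nat_trans level_nat lev by blast
      then show ?thesis unfolding L_def using lev by blast
    qed
  next
    fix x y assume xy: "x \<epsilon> V" "y \<epsilon> V" "x \<noteq> y"
    then obtain m n where lev: "level x m" "level y n" using level_ex by blast
    then have "m \<epsilon> n \<or> m = n \<or> n \<epsilon> m" using nat_linear level_nat by blast
    moreover have "L x y \<or> L y x" if "m = n"
    proof -
      obtain R where R: "ch m R" using ch_ex level_nat lev by blast
      have "x \<epsilon> sphere m" "y \<epsilon> sphere m"
        using lev that unfolding mem_sphere level_def by blast+
      then have "pair x y \<epsilon> R \<or> pair y x \<epsilon> R" using nat_order_total[OF ch_order[OF R]] xy(3) by blast
      then show ?thesis unfolding L_def using lev that R by blast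
    qed
    ultimately show "L x y \<or> L y x" unfolding L_def using lev by blast
  next
    fix P x assume P: "dfn1 P" and x: "x \<epsilon> V" "P x"
    \<comment> \<open>A least vertex is found in two stages: the least level at which
      \<open>P\<close> occurs, and then the least such vertex of that level in the order chosen for
      the sphere.\<close>
    define Q where "Q n \<longleftrightarrow> (\<exists>v. level v n \<and> P v)" for n
    have "dfn1 Q" unfolding Q_def by (intro dfn dfn_subst1[OF P])
    moreover obtain n0 where "Q n0" "n0 \<epsilon> om" using level_ex x level_nat unfolding Q_def by blast
    ultimately obtain n where n: "n \<epsilon> om" "Q n" "\<forall>k. k \<epsilon> n \<longrightarrow> \<not> Q k"
      using nat_least by blast
    then obtain v where v: "level v n" "P v" unfolding Q_def by blast
    obtain R where R: "ch n R" using ch_ex n(1) by blast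
    \<comment> \<open>\<open>sphere n\<close> may also contain vertices of lower level, so the
      search is confined to level \<open>n\<close>.\<close>
    define P' where "P' v \<longleftrightarrow> level v n \<and> P v" for v
    have "dfn1 P'" unfolding P'_def by (intro dfn dfn_subst1[OF P])
    moreover have "v \<epsilon> sphere n" "P' v" using v unfolding mem_sphere level_def P'_def by blast+
    ultimately obtain m where m: "m \<epsilon> sphere n" "P' m" "\<forall>k. pair k m \<epsilon> R \<longrightarrow> \<not> P' k"
      using nat_order_least[OF ch_order[OF R]] by blast
    have "\<not> P k" if "L k m" for k
    proof
      assume "P k"
      obtain i j where ij: "level k i" "level m j"
        "i \<epsilon> j \<or> i = j \<and> (\<exists>R. ch i R \<and> pair k m \<epsilon> R)"
        using \<open>L k m\<close> unfolding L_def by blast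
      have "j = n" using ij(2) m(2) level_unique unfolding P'_def by blast
      then show False
        using ij n(3) m(3) \<open>P k\<close> R ch_unique unfolding Q_def P'_def by blast
    qed
    moreover have "m \<epsilon> V" using m(1) reach_vertex unfolding mem_sphere by blast
    ultimately show "\<exists>m. m \<epsilon> V \<and> P m \<and> (\<forall>k. k \<epsilon> V \<longrightarrow> L k m \<longrightarrow> \<not> P k)"
      using m(2) unfolding P'_def by blast
  qed
qed

end

theorem (in zf) choice_imp_maximal_independent:
  assumes choice_fin_omega
  shows maximal_independent_lf_c
  unfolding maximal_independent_lf_c_def
proof (intro allI impI)
  fix V Ed assume g: "graph V Ed \<and> locally_finite V Ed \<and> connected V Ed"
  show "\<exists>I. maximal_independent V Ed I"
  proof (cases "\<exists>r. r \<epsilon> V")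
    case True
    then obtain r where "r \<epsilon> V" by blast
    then interpret rooted_graph E e0 V Ed r using g by unfold_locales auto
    show ?thesis using maximal_independent_exists[OF assms] .
  next
    case False
    \<comment> \<open>Without vertices there is no root; here the empty set is the only
      candidate.\<close>
    then have "maximal_independent V Ed emp"
      unfolding maximal_independent_def independent_def subset_def
      by (auto intro: extensionality)
    then show ?thesis by blast
  qed
qed

section \<open>From maximal independent sets to choice\<close>

context zf
begin

section \<open>Extending paths, and neighbours in a maximal independent set\<close>

lemma reach_refl: "u \<epsilon> V \<Longrightarrow> reach V Ed u u emp"
proof -
  assume u: "u \<epsilon> V"
  let ?p = "ins (pair emp u) emp"
  have "isfun ?p (suc emp) V" unfolding isfun_def using u by auto
  then have "path V Ed emp ?p u u" unfolding path_def injective_def by auto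
  then show ?thesis unfolding reach_def using emp_om by blast
qed

text \<open>A path ending next to \<open>w'\<close> either passes through \<open>w'\<close>, and is cut there, or can be extended by it.\<close>

lemma reach_joined:
  assumes g: "graph V Ed" and w: "reach V Ed u w n" and j: "joined Ed w w'"
  shows "\<exists>m. reach V Ed u w' m"
proof -
  obtain p where path: "path V Ed n p u w" and n: "n \<epsilon> om" using w unfolding reach_def by blast
  have p: "isfun p (suc n) V" "injective p" "pair emp u \<epsilon> p" "pair n w \<epsilon> p"
    and edge: "\<And>i x y. i \<epsilon> n \<Longrightarrow> pair i x \<epsilon> p \<Longrightarrow> pair (suc i) y \<epsilon> p \<Longrightarrow> joined Ed x y"
    using path unfolding path_def by auto
  show ?thesis
  proof (cases "\<exists>i. pair i w' \<epsilon> p")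
    case True
    then show ?thesis using path_prefix[OF path n] by blast
  next
    case False
    let ?q = "ins (pair (suc n) w') p"
    have pair: "pair k x \<epsilon> ?q \<longleftrightarrow> k = suc n \<and> x = w' \<or> pair k x \<epsilon> p" for k x by auto
    have new: "\<not> pair (suc n) x \<epsilon> p" for x using isfun_memD[OF p(1)] not_mem_self by blast
    have w': "w' \<epsilon> V" using graph_joinedD[OF g j] by blast
    have "isfun ?q (suc (suc n)) V"
      unfolding isfun_def
    proof (intro conjI allI impI)
      fix z assume "z \<epsilon> ?q"
      then consider "z = pair (suc n) w'" | "z \<epsilon> p" by auto
      then show "\<exists>x y. x \<epsilon> suc (suc n) \<and> y \<epsilon> V \<and> z = pair x y"
      proof cases
        case 1
        then show ?thesis using w' mem_suc by blast
      next
        case 2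
        then obtain x y where "x \<epsilon> suc n" "y \<epsilon> V" "z = pair x y"
          using p(1) unfolding isfun_def by blast
        then show ?thesis using mem_suc[of x "suc n"] by blast
      qed
    next
      fix x assume "x \<epsilon> suc (suc n)"
      then consider "x = suc n" | "x \<epsilon> suc n" unfolding mem_suc[of x "suc n"] by blast
      then show "\<exists>y. pair x y \<epsilon> ?q \<and> (\<forall>z. pair x z \<epsilon> ?q \<longrightarrow> z = y)"
      proof cases
        case 1
        then show ?thesis unfolding pair using new by blast
      next
        case 2
        then have "x \<noteq> suc n" using not_mem_self by blast
        then show ?thesis unfolding pair using isfun_ex[OF p(1) 2] isfun_unique[OF p(1)] by blast
      qed
    qed
    moreover have "injective ?q"
      unfolding injective_def pair using False injectiveD[OF p(2)] by blast
    moreover have "joined Ed x y" if i: "i \<epsilon> suc n" and x: "pair i x \<epsilon> ?q" and y: "pair (suc i) y \<epsilon> ?q"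
      for i x y
    proof -
      have "i \<noteq> suc n" using i not_mem_self by blast
      then have x': "pair i x \<epsilon> p" using x unfolding pair by blast
      show ?thesis
      proof (cases "i = n")
        case True
        then have "x = w" using isfun_unique[OF p(1)] x' p(4) by blast
        moreover have "y = w'" using y True new unfolding pair by blast
        ultimately show ?thesis using j by simp
      next
        case False
        then have "pair (suc i) y \<epsilon> p" using y unfolding pair by simp
        moreover have "i \<epsilon> n" using False i by simp
        ultimately show ?thesis using edge x' by blast
      qed
    qed
    ultimately have "path V Ed (suc n) ?q u w'"
      unfolding path_def using p(3) by auto
    then show ?thesis using suc_om[OF n] unfolding reach_def by blast
  qed
qed

text \<open>Otherwise \<open>ins v I\<close> would be a larger independent set; \<open>v\<close> is
  not joined to itself because the ends of an edge are distinct.\<close>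

lemma maximal_independent_neighbour:
  assumes "graph V Ed" "maximal_independent V Ed I" "v \<epsilon> V" "\<not> v \<epsilon> I"
  shows "\<exists>w. w \<epsilon> I \<and> joined Ed v w"
proof (rule ccontr)
  assume none: "\<not> ?thesis"
  have I: "independent V Ed I" using assms(2) unfolding maximal_independent_def by blast
  have "\<not> joined Ed v v" using graph_joinedD(3)[OF assms(1)] by blast
  then have "\<not> joined Ed x y" if "x = v \<or> x \<epsilon> I" "y = v \<or> y \<epsilon> I" for x y
    using that none I joined_sym[of Ed x v] unfolding independent_def by blast
  then have "independent V Ed (ins v I)"
    using I assms(3) unfolding independent_def by (auto simp: subset_def)
  moreover have "subset I (ins v I)" by (simp add: subset_def)
  moreover have "I \<noteq> ins v I" using assms(4) by (metis mem_ins)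
  ultimately show False using assms(2) unfolding maximal_independent_def by blast
qed

end

text \<open>
  Over the family \<open>A\<close>, numbered by \<open>F\<close>, the vertices are triples \<open>(i, a, x)\<close> with \<open>i\<close> in \<open>{0, 1}\<close>,
  \<open>a\<close> in \<open>A\<close> and \<open>x\<close> in \<open>a \<union> {a}\<close>. For fixed \<open>i\<close> and \<open>a\<close> they form a clique with hub \<open>(i, a, a)\<close>,
  and the hubs form a ladder along \<open>F\<close>. A maximal independent set selects an element of \<open>a\<close> in each of
  the two cliques of \<open>a\<close> whose hub it avoids; it avoids at least one hub, as the two are adjacent.
\<close>

locale ladder = zf E e0 for E :: "'a \<Rightarrow> 'a \<Rightarrow> bool" (infix "\<epsilon>" 50) and e0 +
  fixes A F :: 'a
  assumes F: "isfun F A om" "injective F" "onto F om"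
    and nonempty: "a \<epsilon> A \<Longrightarrow> \<exists>x. x \<epsilon> a" and fin: "a \<epsilon> A \<Longrightarrow> Fin a"
begin

abbreviation one :: 'a where
  "one \<equiv> suc emp"

abbreviation two :: 'a where
  "two \<equiv> suc one"

definition vert :: "'a \<Rightarrow> 'a \<Rightarrow> 'a \<Rightarrow> 'a" where
  "vert i a x = pair i (pair a x)"

lemma dt_vert [dfn]:
  "dterm f \<Longrightarrow> dterm g \<Longrightarrow> dterm h \<Longrightarrow> dterm (\<lambda>v. vert (f v) (g v) (h v))"
  unfolding vert_def by (intro dfn)

lemma vert_inject [simp]: "vert i a x = vert j b y \<longleftrightarrow> i = j \<and> a = b \<and> x = y"
  by (simp add: vert_def)

text \<open>By foundation \<open>a\<close> is not an element of itself, so it can label the hub. The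
  middle coordinate keeps the cliques of overlapping members of \<open>A\<close> disjoint.\<close>

definition V :: 'a where
  "V = sep (prod two (prod A (un A (union A)))) (\<lambda>v. \<exists>i a x. v = vert i a x \<and> x \<epsilon> suc a)"

lemma mem_V: "v \<epsilon> V \<longleftrightarrow> (\<exists>i a x. v = vert i a x \<and> i \<epsilon> two \<and> a \<epsilon> A \<and> x \<epsilon> suc a)"
proof -
  have "v \<epsilon> V \<longleftrightarrow> v \<epsilon> prod two (prod A (un A (union A))) \<and>
      (\<exists>i a x. v = vert i a x \<and> x \<epsilon> suc a)"
    unfolding V_def by (rule mem_sep) (intro dfn)
  moreover have "vert i a x \<epsilon> prod two (prod A (un A (union A))) \<longleftrightarrow> i \<epsilon> two \<and> a \<epsilon> A"
    if "x \<epsilon> suc a" for i a x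
    using that unfolding vert_def pair_mem_prod mem_un mem_union mem_suc[of x a] by blast
  ultimately show ?thesis by blast
qed

lemma vert_V [simp]: "vert i a x \<epsilon> V \<longleftrightarrow> i \<epsilon> two \<and> a \<epsilon> A \<and> x \<epsilon> suc a"
  unfolding mem_V by auto

text \<open>The case \<open>m = n\<close> is what joins the two hubs of a single member.\<close>

definition near :: "'a \<Rightarrow> 'a \<Rightarrow> bool" where
  "near a b \<longleftrightarrow> (\<exists>m n. pair a m \<epsilon> F \<and> pair b n \<epsilon> F \<and> (m = n \<or> n = suc m \<or> m = suc n))"

text \<open>Hubs of near members are joined whatever \<open>i\<close> and \<open>j\<close> are,
  hence also diagonally. Only hubs have neighbours outside their own clique.\<close>

definition adj :: "'a \<Rightarrow> 'a \<Rightarrow> bool" where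
  "adj u v \<longleftrightarrow> u \<noteq> v \<and> (\<exists>i a x j b y. u = vert i a x \<and> v = vert j b y \<and>
     (i = j \<and> a = b \<or> x = a \<and> y = b \<and> near a b))"

definition Ed :: 'a where
  "Ed = sep (pow V) (\<lambda>e. \<exists>u v. u \<epsilon> V \<and> v \<epsilon> V \<and> adj u v \<and> e = upair u v)"

lemma mem_Ed: "e \<epsilon> Ed \<longleftrightarrow> (\<exists>u v. u \<epsilon> V \<and> v \<epsilon> V \<and> adj u v \<and> e = upair u v)"
proof -
  have "e \<epsilon> Ed \<longleftrightarrow> e \<epsilon> pow V \<and> (\<exists>u v. u \<epsilon> V \<and> v \<epsilon> V \<and> adj u v \<and> e = upair u v)"
    unfolding Ed_def by (rule mem_sep) (unfold adj_def near_def, intro dfn)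
  then show ?thesis by (auto simp: subset_def)
qed

lemma near_sym: "near a b \<Longrightarrow> near b a"
  unfolding near_def by metis

lemma adj_sym: "adj u v \<Longrightarrow> adj v u"
  unfolding adj_def using near_sym by metis

lemma joined_iff: "joined Ed u v \<longleftrightarrow> u \<epsilon> V \<and> v \<epsilon> V \<and> adj u v"
  unfolding joined_def mem_Ed upair_eq_iff using adj_sym by blast

lemma joined_vert: "joined Ed (vert i a x) (vert j b y) \<longleftrightarrow>
    vert i a x \<epsilon> V \<and> vert j b y \<epsilon> V \<and> \<not> (i = j \<and> a = b \<and> x = y) \<and>
    (i = j \<and> a = b \<or> x = a \<and> y = b \<and> near a b)"
  unfolding joined_iff adj_def vert_inject by blast

lemma graph: "graph V Ed"
  unfolding graph_def mem_Ed adj_def by blast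

lemma index_ex: "a \<epsilon> A \<Longrightarrow> \<exists>n. n \<epsilon> om \<and> pair a n \<epsilon> F"
  using isfun_ex[OF F(1)] isfun_memD[OF F(1)] by blast

lemma near_refl: "a \<epsilon> A \<Longrightarrow> near a a"
  unfolding near_def using index_ex by blast

text \<open>The neighbours of a vertex over the member numbered \<open>n\<close> lie over members
  numbered at most \<open>suc n\<close>. These are finitely many finite sets, so all edges at the
  vertex are subsets of one finite set \<open>W\<close>.\<close>

lemma locally_finite: "locally_finite V Ed"
  unfolding locally_finite_def
proof (intro allI impI)
  fix v assume "v \<epsilon> V"
  then obtain i a x where v: "v = vert i a x" "i \<epsilon> two" "a \<epsilon> A" "x \<epsilon> suc a"
    unfolding mem_V by blast
  then obtain n where n: "n \<epsilon> om" "pair a n \<epsilon> F" using index_ex by blast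
  \<comment> \<open>\<open>suc (suc n)\<close> is the set of numbers up to \<open>suc n\<close>, the
    highest that a neighbour can have.\<close>
  define B where "B = sep A (\<lambda>b. \<exists>k. pair b k \<epsilon> F \<and> k \<epsilon> suc (suc n))"
  have B: "b \<epsilon> B \<longleftrightarrow> b \<epsilon> A \<and> (\<exists>k. pair b k \<epsilon> F \<and> k \<epsilon> suc (suc n))" for b
    unfolding B_def by (rule mem_sep) (intro dfn)
  have "Fin B"
  proof (rule Fin_image[of "suc (suc n)" "\<lambda>k b. pair b k \<epsilon> F"])
    show "Fin (suc (suc n))" using n(1) by (intro Fin_nat suc_om)
    show "dfn2 (\<lambda>k b. pair b k \<epsilon> F)" by (intro dfn)
  qed (use B injectiveD[OF F(2)] in blast)+
  moreover have "Fin (union B)"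
    by (rule Fin_union[OF \<open>Fin B\<close>]) (use B fin in blast)
  moreover have "Fin two" by (intro Fin_nat suc_om emp_om)
  moreover define W where "W = prod two (prod B (un B (union B)))"
  ultimately have "Fin (pow W)" by (auto intro!: Fin_pow Fin_prod Fin_un)
  then show "Fin (sep Ed (\<lambda>e. v \<epsilon> e))"
  proof (rule Fin_subset)
    have W: "vert j b y \<epsilon> W" if "j \<epsilon> two" "b \<epsilon> B" "y \<epsilon> suc b" for j b y
      using that unfolding W_def vert_def pair_mem_prod mem_un mem_union mem_suc[of y b] by blast
    fix e assume "e \<epsilon> sep Ed (\<lambda>e. v \<epsilon> e)"
    then have e: "e \<epsilon> Ed" "v \<epsilon> e" unfolding mem_incident by auto
    from e(1) obtain u w where uw: "u \<epsilon> V" "w \<epsilon> V" "adj u w" "e = upair u w"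
      unfolding mem_Ed by blast
    then obtain w' where w': "w' \<epsilon> V" "adj v w'" and e: "\<And>z. z \<epsilon> e \<Longrightarrow> z = v \<or> z = w'"
      using e(2) adj_sym by (metis mem_upair)
    obtain j b y where vw: "w' = vert j b y" "a = b \<or> near a b"
      using w'(2) v(1) unfolding adj_def by auto
    then have "near a b" using near_refl v(3) by blast
    then obtain m k where mk: "pair a m \<epsilon> F" "pair b k \<epsilon> F" "m = k \<or> k = suc m \<or> m = suc k"
      unfolding near_def by blast
    have "m = n" using isfun_unique[OF F(1)] mk(1) n(2) by blast
    then have "k \<epsilon> suc (suc n)" using mk(3) by auto
    then have "b \<epsilon> B" using mk(2) w'(1) vw(1) B by auto
    then have "w' \<epsilon> W" using w'(1) vw(1) W by simp
    moreover have "v \<epsilon> W"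
      unfolding v(1) using v(2-4) n(2) B[of a] mem_suc by (intro W) blast+
    ultimately show "e \<epsilon> pow W" using e by (auto simp: subset_def)
  qed
qed

text \<open>Reachability from \<open>u\<close> is preserved along edges in both directions, so its
  truth value at every vertex is that at the hub \<open>vert emp a0 a0\<close>. It is true at
  \<open>u\<close>, hence everywhere; this way no two paths have to be concatenated.\<close>

lemma connected: "connected V Ed"
  unfolding connected_def
proof (intro allI impI)
  fix u v assume uv: "u \<epsilon> V \<and> v \<epsilon> V"
  define P where "P v \<longleftrightarrow> (\<exists>n. reach V Ed u v n)" for v
  have step: "P w \<longleftrightarrow> P w'" if "joined Ed w w'" for w w'
    using that reach_joined[OF graph] joined_sym unfolding P_def by blast
  have emp_two: "emp \<epsilon> two" by simp
  have hub: "P (vert i a x) \<longleftrightarrow> P (vert emp a a)" if "vert i a x \<epsilon> V" for i a x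
  proof -
    have ia: "i \<epsilon> two" "a \<epsilon> A" "x \<epsilon> suc a" using that by auto
    have a: "a \<epsilon> suc a" by simp
    have "P (vert i a x) \<longleftrightarrow> P (vert i a a)"
    proof (cases "x = a")
      case False
      then have "joined Ed (vert i a x) (vert i a a)" unfolding joined_vert using ia a by simp
      then show ?thesis by (rule step)
    qed simp
    also have "\<dots> \<longleftrightarrow> P (vert emp a a)"
    proof (cases "i = emp")
      case False
      then have "joined Ed (vert i a a) (vert emp a a)"
        unfolding joined_vert using ia a near_refl by simp
      then show ?thesis by (rule step)
    qed simp
    finally show ?thesis .
  qed
  have near: "P (vert emp a a) \<longleftrightarrow> P (vert emp b b)" if "near a b" for a b
  proof (cases "a = b")
    case False
    have "a \<epsilon> A" "b \<epsilon> A" using that isfun_memD[OF F(1)] unfolding near_def by blast+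
    then have "joined Ed (vert emp a a) (vert emp b b)"
      unfolding joined_vert using that False by simp
    then show ?thesis by (rule step)
  qed simp
  obtain a0 where a0: "pair a0 emp \<epsilon> F" using ontoD[OF F(3) emp_om] by blast
  \<comment> \<open>Induction in \<open>om\<close> along the hubs with first coordinate
    \<open>emp\<close>.\<close>
  have ladder: "\<forall>a. pair a n \<epsilon> F \<longrightarrow> (P (vert emp a a) \<longleftrightarrow> P (vert emp a0 a0))"
    if "n \<epsilon> om" for n
    using that
  proof (rule om_induct)
    show "dfn1 (\<lambda>n. \<forall>a. pair a n \<epsilon> F \<longrightarrow> (P (vert emp a a) \<longleftrightarrow> P (vert emp a0 a0)))"
      unfolding P_def by (intro dfn)
    show "\<forall>a. pair a emp \<epsilon> F \<longrightarrow> (P (vert emp a a) \<longleftrightarrow> P (vert emp a0 a0))"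
      using a0 injectiveD[OF F(2)] by blast
    fix n assume n: "n \<epsilon> om"
      and IH: "\<forall>a. pair a n \<epsilon> F \<longrightarrow> (P (vert emp a a) \<longleftrightarrow> P (vert emp a0 a0))"
    show "\<forall>a. pair a (suc n) \<epsilon> F \<longrightarrow> (P (vert emp a a) \<longleftrightarrow> P (vert emp a0 a0))"
    proof (intro allI impI)
      fix a assume a: "pair a (suc n) \<epsilon> F"
      obtain b where b: "pair b n \<epsilon> F" using ontoD[OF F(3) n] by blast
      then have "near a b" using a unfolding near_def by blast
      then show "P (vert emp a a) \<longleftrightarrow> P (vert emp a0 a0)" using near IH b by blast
    qed
  qed
  have "P w \<longleftrightarrow> P (vert emp a0 a0)" if w: "w \<epsilon> V" for w
  proof -
    obtain i a x where w': "w = vert i a x" "a \<epsilon> A" using w unfolding mem_V by blast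
    obtain n where "n \<epsilon> om" "pair a n \<epsilon> F" using index_ex w'(2) by blast
    then have "P (vert emp a a) \<longleftrightarrow> P (vert emp a0 a0)" using ladder by blast
    then show ?thesis using hub w w'(1) by blast
  qed
  moreover have "P u" unfolding P_def using reach_refl uv by blast
  ultimately show "\<exists>n. reach V Ed u v n" using uv unfolding P_def by blast
qed

section \<open>Reading off a choice function from a maximal independent set\<close>

lemma choice_function_exists:
  assumes I: "maximal_independent V Ed I"
  shows "\<exists>f. choice_function f A"
proof -
  have indep: "\<not> joined Ed u v" if "u \<epsilon> I" "v \<epsilon> I" for u v
    using I that unfolding maximal_independent_def independent_def by blast
  have IV: "v \<epsilon> V" if "v \<epsilon> I" for v
    using I that unfolding maximal_independent_def independent_def subset_def by blast
  have unique: "x = y" if "vert i a x \<epsilon> I" "vert i a y \<epsilon> I" for i a x y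
    using indep[OF that] IV[OF that(1)] IV[OF that(2)] unfolding joined_vert by blast
  \<comment> \<open>A vertex that is not a hub has all its neighbours in its own clique. If it is
    outside \<open>I\<close>, a neighbour in \<open>I\<close> other than the hub provides the
    element of \<open>a\<close>.\<close>
  have ex: "\<exists>x. x \<epsilon> a \<and> vert i a x \<epsilon> I" if a: "a \<epsilon> A" and i: "i \<epsilon> two" and hub: "\<not> vert i a a \<epsilon> I"
    for a i
  proof -
    obtain x where x: "x \<epsilon> a" using nonempty[OF a] by blast
    show ?thesis
    proof (cases "vert i a x \<epsilon> I")
      case False
      have "vert i a x \<epsilon> V" using a i x by simp
      then obtain w where w: "w \<epsilon> I" "joined Ed (vert i a x) w"
        using maximal_independent_neighbour[OF graph I _ False] by blast
      then obtain j b y where w': "w = vert j b y" using IV mem_V by blast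
      have "x \<noteq> a" using x not_mem_self by blast
      then have "w = vert i a y" "y \<epsilon> suc a" using w(2) unfolding w' joined_vert by auto
      then show ?thesis using w(1) hub by auto
    qed (use x in blast)
  qed
  \<comment> \<open>Side \<open>emp\<close> has priority, and side \<open>one\<close> counts only if
    the hub of side \<open>emp\<close> is in \<open>I\<close>. Without this guard the two sides
    could select different elements.\<close>
  define sel where "sel a x \<longleftrightarrow> x \<epsilon> a \<and>
    (vert emp a x \<epsilon> I \<or> vert emp a a \<epsilon> I \<and> vert one a x \<epsilon> I)" for a x
  have total: "\<exists>x. x \<epsilon> union A \<and> sel a x" if a: "a \<epsilon> A" for a
  proof -
    have "\<exists>x. sel a x"
    proof (cases "vert emp a a \<epsilon> I")
      case True
      have "joined Ed (vert emp a a) (vert one a a)"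
        unfolding joined_vert using a near_refl by simp
      then have "\<not> vert one a a \<epsilon> I" using indep True by blast
      then obtain x where "x \<epsilon> a" "vert one a x \<epsilon> I" using ex[OF a, of one] by auto
      then show ?thesis unfolding sel_def using True by blast
    next
      case False
      then show ?thesis unfolding sel_def using ex[OF a, of emp] by auto
    qed
    then show ?thesis using a unfolding sel_def by auto
  qed
  have sel_unique: "x = y" if "sel a x" "sel a y" for a x y
  proof (cases "vert emp a a \<epsilon> I")
    case True
    then have "\<not> vert emp a z \<epsilon> I" if "z \<epsilon> a" for z using unique that not_mem_self by blast
    then show ?thesis using that unique unfolding sel_def by blast
  next
    case False
    then show ?thesis using that unique unfolding sel_def by blast
  qed
  have "dfn2 sel" unfolding sel_def by (intro dfn)
  then obtain f where "isfun f A (union A)"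
    and f: "\<And>x y. pair x y \<epsilon> f \<longleftrightarrow> x \<epsilon> A \<and> y \<epsilon> union A \<and> sel x y"
    by (rule function_from_relation) (use total sel_unique in blast)+
  then have "choice_function f A" unfolding choice_function_def sel_def by blast
  then show ?thesis by blast
qed

end

theorem (in zf) maximal_independent_imp_choice:
  assumes maximal_independent_lf_c
  shows choice_fin_omega
  unfolding choice_fin_omega_def
proof (intro allI impI)
  fix A assume A: "eqp A om \<and> (\<forall>x. x \<epsilon> A \<longrightarrow> (\<exists>y. y \<epsilon> x) \<and> Fin x)"
  then obtain F where F: "isfun F A om" "injective F" "onto F om" unfolding eqp_def by blast
  interpret ladder E e0 A F using A F by unfold_locales blast+
  show "\<exists>f. choice_function f A"
    using assms graph locally_finite connected choice_function_exists
    unfolding maximal_independent_lf_c_def by blast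
qed

theorem proposition3p3: "ZF \<turnstile> formula (AC_fin_omega \<^bold>\<longleftrightarrow> P_lf_c)"
proof (rule ccontr)
  let ?p = "formula (AC_fin_omega \<^bold>\<longleftrightarrow> P_lf_c)"
  assume "\<not> (ZF \<turnstile> ?p)"
  then have "consistent (insert (Imp ?p Fls) ZF)" using Raa by blast
  then obtain M :: "nat \<Rightarrow> nat \<Rightarrow> bool" and e
    where M: "\<And>q. q \<in> insert (Imp ?p Fls) ZF \<Longrightarrow> sat (=) M e q"
    by (rule ZF_model_existence) blast+
  interpret zf M e using M by unfold_locales blast
  have "sat (=) M e ?p"
    unfolding sat_formula[where v = undefined] holds_iff holds_AC_fin_omega holds_P_lf_c
    using choice_imp_maximal_independent maximal_independent_imp_choice by blast
  then show False using M[of "Imp ?p Fls"] by simp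
qed

end
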